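(* Let $c>0$, $t>0$ and $n\ge 1$ an integer, and let $\underline{\mathbf X}_d(t)$ and $\underline{\mathbf Y}_d(t)$ be the positions at time $t$ of the $d$-dimensional random flights with $n$ changes of direction defined in the context. (i) For every integer $d\ge 2$ and every $\underline{\alpha}_d\in\mathbb{R}^d\setminus\{0\}$, $$E\left\{e^{i\langle\underline{\alpha}_d,\underline{\mathbf X}_d(t)\rangle}\right\}=\frac{2^{\frac{n+1}{2}(d-1)-\frac12}\,\Gamma\left(\frac{n+1}{2}(d-1)+\frac12\right)}{(ct\|\underline{\alpha}_d\|)^{\frac{n+1}{2}(d-1)-\frac12}}\,J_{\frac{n+1}{2}(d-1)-\frac12}(ct\|\underline{\alpha}_d\|).$$ (ii) For every integer $d\ge 3$ and every $\underline{\alpha}_d\in\mathbb{R}^d\setminus\{0\}$, $$E\left\{e^{i\langle\underline{\alpha}_d,\underline{\mathbf Y}_d(t)\rangle}\right\}=\frac{2^{(n+1)(\frac d2-1)}\,\Gamma\left((n+1)(\frac d2-1)+1\right)}{(ct\|\underline{\alpha}_d\|)^{(n+1)(\frac d2-1)}}\,J_{(n+1)(\frac d2-1)}(ct\|\underline{\alpha}_d\|).$$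
   Context: $\langle\cdot,\cdot\rangle$ and $\|\cdot\|$ are the Euclidean scalar product and norm on $\mathbb{R}^d$. $J_\nu(x)=\sum_{k=0}^\infty(-1)^k\left(\frac{x}{2}\right)^{2k+\nu}\frac{1}{k!\,\Gamma(k+\nu+1)}$ is the Bessel function. Random flights with a fixed number $n\ge1$ of changes of direction. Fix $c>0$ (speed), $t>0$. Let $V_1,\dots,V_{n+1}$ be independent random vectors uniformly distributed on the unit sphere of $\mathbb{R}^d$ (in hyperspherical coordinates $(\theta_1,\dots,\theta_{d-2},\phi)\in[0,\pi]^{d-2}\times[0,2\pi]$ each has joint density $\frac{\Gamma(d/2)}{2\pi^{d/2}}\sin^{d-2}\theta_1\sin^{d-3}\theta_2\cdots\sin\theta_{d-2}$). Let $(\tau_1,\dots,\tau_n)$ be a random vector independent of the $V_j$'s, with $\tau_j>0$, $\sum_{j=1}^n\tau_j<t$, and put $\tau_{n+1}=t-\sum_{j=1}^n\tau_j$. The position at time $t$ is $c\sum_{j=1}^{n+1}\tau_jV_j$. For $d\ge2$, $\underline{\mathbf X}_d(t)=(X_1(t),\dots,X_d(t))$ denotes this position when $(\tau_1,\dots,\tau_n)$ has the rescaled Dirichlet density $$f_1(\tau_1,\dots,\tau_n)=\frac{\Gamma((n+1)(d-1))}{(\Gamma(d-1))^{n+1}}\frac{1}{t^{(n+1)(d-1)-1}}\prod_{j=1}^{n+1}\tau_j^{d-2}$$ on $\{\tau_j>0,\ \sum_{j=1}^n\tau_j<t\}$. For $d\ge3$, $\underline{\mathbf Y}_d(t)=(Y_1(t),\dots,Y_d(t))$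 denotes this position when $(\tau_1,\dots,\tau_n)$ has the rescaled Dirichlet density $$f_2(\tau_1,\dots,\tau_n)=\frac{\Gamma((n+1)(\frac d2-1))}{(\Gamma(\frac d2-1))^{n+1}}\frac{1}{t^{(n+1)(\frac d2-1)-1}}\prod_{j=1}^{n+1}\tau_j^{\frac d2-2}$$ on the same set. *)

theory Defs
  imports "HOL-Probability.Probability"
begin

text \<open>At poles of \<open>Gamma\<close> the library has \<open>Gamma = 0\<close>, so the corresponding summand is \<open>0\<close>, in
  accordance with the usual convention \<open>1/Gamma = 0\<close>. Only \<open>x > 0\<close> is meaningful for
  non-integer \<open>\<nu>\<close>, because of the real power.\<close>

definition Bessel_J :: "real \<Rightarrow> real \<Rightarrow> real" where
  "Bessel_J \<nu> x =
     (\<Sum>k. (-1) ^ k * (x / 2) powr (2 * real k + \<nu>) * (1 / (fact k * Gamma (real k + \<nu> + 1))))"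

text \<open>Hyperspherical coordinates in dimension \<open>d \<ge> 2\<close>: the angles are \<open>\<theta> 1, \<dots>, \<theta> (d - 2)\<close> in
  \<open>[0, \<pi>]\<close> and \<open>\<phi> = \<theta> (d - 1)\<close> in \<open>[0, 2\<pi>]\<close>.\<close>

definition hyperspherical_angles :: "nat \<Rightarrow> (nat \<Rightarrow> real) set" where
  "hyperspherical_angles d =
     {\<theta>. (\<forall>i\<in>{1..d - 2}. 0 \<le> \<theta> i \<and> \<theta> i \<le> pi) \<and> 0 \<le> \<theta> (d - 1) \<and> \<theta> (d - 1) \<le> 2 * pi}"

definition hyperspherical_density :: "nat \<Rightarrow> (nat \<Rightarrow> real) \<Rightarrow> real" where
  "hyperspherical_density d \<theta> =
     Gamma (real d / 2) / (2 * pi powr (real d / 2)) * (\<Prod>i=1..d - 2. sin (\<theta> i) ^ (d - 1 - i))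
       * indicator (hyperspherical_angles d) \<theta>"

text \<open>The Cartesian coordinates, numbered from \<open>0\<close>, are \<open>cos (\<theta> 1)\<close>, \<open>sin (\<theta> 1) cos (\<theta> 2)\<close>,
  \<open>\<dots>\<close>, \<open>sin (\<theta> 1) \<dots> sin (\<theta> (d - 2)) cos \<phi>\<close>, \<open>sin (\<theta> 1) \<dots> sin (\<theta> (d - 2)) sin \<phi>\<close>. On a
  finite type \<open>to_nat_on UNIV\<close> is a bijection onto \<open>{..<CARD('d)}\<close>; it serves to number the
  coordinates of \<open>real ^ 'd\<close>.\<close>

definition hyperspherical_point :: "(nat \<Rightarrow> real) \<Rightarrow> real ^ 'd::finite" where
  "hyperspherical_point \<theta> =
     (\<chi> k. let i = to_nat_on (UNIV :: 'd set) k
          in (\<Prod>j=1..i. sin (\<theta> j)) * (if i < CARD('d) - 1 then cos (\<theta> (i + 1)) else 1))"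

definition uniform_sphere :: "(real ^ 'd::finite) measure" where
  "uniform_sphere =
     distr (density (PiM {1..CARD('d) - 1} (\<lambda>_. lborel))
              (\<lambda>\<theta>. ennreal (hyperspherical_density CARD('d) \<theta>)))
       borel hyperspherical_point"

text \<open>The \<open>n + 1\<close> durations, determined by the first \<open>n\<close> of them and the total time \<open>t\<close>.\<close>

definition duration :: "real \<Rightarrow> nat \<Rightarrow> (nat \<Rightarrow> real) \<Rightarrow> nat \<Rightarrow> real" where
  "duration t n \<tau> j = (if j = n + 1 then t - (\<Sum>i=1..n. \<tau> i) else \<tau> j)"

text \<open>The rescaled symmetric Dirichlet density with parameter \<open>a\<close>. The flights below use
  \<open>a = d - 1\<close> (density \<open>f\<^sub>1\<close>) and \<open>a = d / 2 - 1\<close> (density \<open>f\<^sub>2\<close>).\<close>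

definition dirichlet_density :: "real \<Rightarrow> real \<Rightarrow> nat \<Rightarrow> (nat \<Rightarrow> real) \<Rightarrow> real" where
  "dirichlet_density a t n \<tau> =
     Gamma (real (n + 1) * a) / Gamma a ^ (n + 1) * (1 / t powr (real (n + 1) * a - 1))
       * (\<Prod>j=1..n + 1. duration t n \<tau> j powr (a - 1))
       * indicator {\<tau>. (\<forall>j\<in>{1..n}. 0 < \<tau> j) \<and> (\<Sum>j=1..n. \<tau> j) < t} \<tau>"

text \<open>Independence of two random elements with values in possibly different types, which
  \<open>indep_var\<close> does not allow.\<close>

definition indep_random_elements ::
  "'w measure \<Rightarrow> 'a measure \<Rightarrow> ('w \<Rightarrow> 'a) \<Rightarrow> 'b measure \<Rightarrow> ('w \<Rightarrow> 'b) \<Rightarrow> bool" where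
  "indep_random_elements M N X N' Y \<longleftrightarrow>
     X \<in> measurable M N \<and> Y \<in> measurable M N' \<and>
     prob_space.indep_set M {X -` A \<inter> space M | A. A \<in> sets N} {Y -` B \<inter> space M | B. B \<in> sets N'}"

text \<open>\<open>V 1, \<dots>, V (n + 1)\<close> are the directions and \<open>\<tau> 1, \<dots>, \<tau> n\<close> the first \<open>n\<close> durations, the
  vector of which has density \<open>f\<close> with respect to Lebesgue measure. The random vectors formed
  by all the directions and by all the durations are independent of each other.\<close>

definition random_flight ::
  "'w measure \<Rightarrow> nat \<Rightarrow> ((nat \<Rightarrow> real) \<Rightarrow> real) \<Rightarrow> (nat \<Rightarrow> 'w \<Rightarrow> real ^ 'd::finite)
     \<Rightarrow> (nat \<Rightarrow> 'w \<Rightarrow> real) \<Rightarrow> bool" where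
  "random_flight M n f V \<tau> \<longleftrightarrow>
     prob_space M \<and>
     prob_space.indep_vars M (\<lambda>_. borel) V {1..n + 1} \<and>
     (\<forall>j\<in>{1..n + 1}. distr M borel (V j) = uniform_sphere) \<and>
     distributed M (PiM {1..n} (\<lambda>_. lborel)) (\<lambda>\<omega>. \<lambda>j\<in>{1..n}. \<tau> j \<omega>) (\<lambda>s. ennreal (f s)) \<and>
     indep_random_elements M
       (PiM {1..n + 1} (\<lambda>_. borel)) (\<lambda>\<omega>. \<lambda>j\<in>{1..n + 1}. V j \<omega>)
       (PiM {1..n} (\<lambda>_. borel)) (\<lambda>\<omega>. \<lambda>j\<in>{1..n}. \<tau> j \<omega>)"

definition flight_position ::
  "real \<Rightarrow> real \<Rightarrow> nat \<Rightarrow> (nat \<Rightarrow> 'w \<Rightarrow> real ^ 'd::finite) \<Rightarrow> (nat \<Rightarrow> 'w \<Rightarrow> real) \<Rightarrow> 'w \<Rightarrow> real ^ 'd"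
  where
  "flight_position c t n V \<tau> \<omega> =
     c *\<^sub>R (\<Sum>j=1..n + 1. duration t n (\<lambda>i. \<tau> i \<omega>) j *\<^sub>R V j \<omega>)"

end

theory Submission
  imports Defs "HOL-Complex_Analysis.Cauchy_Integral_Formula"
begin

text \<open>The position is bounded, so its moment generating function on the real line determines its
  characteristic function, and with the moment generating function all integrands are nonnegative.
  Given the durations, independence of the directions yields a product of factors \<open>\<Lambda> (\<tau>\<^sub>j)\<close>, where
  \<open>\<Lambda>\<close> is a normalized modified Bessel function of order \<open>d / 2 - 1\<close> obtained from the moments of
  the uniform distribution on the sphere. Multiplied by the Dirichlet density this is an
  \<open>(n + 1)\<close>-fold convolution of \<open>s powr (a - 1) * \<Lambda> s\<close>, evaluated at \<open>t\<close>. For both values of \<open>a\<close>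
  this function belongs to a convolution semigroup, which follows by comparing coefficients:
  Vandermonde's identity for \<open>a = d - 1\<close>, the Hagen-Rothe identity for \<open>a = d / 2 - 1\<close>.\<close>

section \<open>The Hagen-Rothe identity\<close>

text \<open>Laplace transforms show where the two semigroups come from. For large p and with z = x /
  p^2, the transform of \<open>bessel_kernel v x l\<close> at p is p^(-l) times the series with
  terms \<open>pochhammer l (2 * k) * bessel_coeff (v l) k\<close> times z^k. For order (l - 1) / 2
  this series is (1 - 4 z)^(-l / 2), and for order l it is the l-th power of the Catalan generating
  function. Both are l-th powers, so convolution adds the parameters; the proof compares
  coefficients instead of inverting transforms. Each direction contributes the order d / 2 - 1,
  which must be the order at the Dirichlet parameter a. The equations (a - 1) / 2 = d / 2 - 1 and a
  = d / 2 - 1 give a = d - 1 and a = d / 2 - 1, the two densities. The order in the result belongs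
  to the parameter (n + 1) a. Nonnegativity matters because Tonelli's theorem, independence and
  termwise integration then hold in \<open>ennreal\<close> without integrability conditions,
  although the density is unbounded near the boundary when a < 1.\<close>

definition hagen_rothe_coeff :: "nat \<Rightarrow> real \<Rightarrow> real" where
  "hagen_rothe_coeff k x =
     (if k = 0 then 1 else x * pochhammer (x + real k + 1) (k - 1) / fact k)"

text \<open>\<open>hagen_rothe_coeff k x\<close> is x / (x + 2 k) * binom(x + 2 k, k), written
  without division by x + 2 k so that it is a polynomial in x. These are the coefficients of the
  x-th power of the series B with B = 1 + z B^2, and the recurrence is the coefficient form of B^x -
  B^(x - 1) = z B^(x + 1).\<close>

lemma hagen_rothe_coeff_step:
  "hagen_rothe_coeff (Suc k) x - hagen_rothe_coeff (Suc k) (x - 1) = hagen_rothe_coeff k (x + 1)"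
proof (cases k)
  case 0
  then show ?thesis by (simp add: hagen_rothe_coeff_def)
next
  case (Suc m)
  \<comment> \<open>All three coefficients contain the factors x + m + 3, ..., x + 2 m + 2; once
    they are taken out, an elementary polynomial identity remains.\<close>
  define P where "P = pochhammer (x + real m + 3) m"
  have 1: "pochhammer (x + real (Suc k) + 1) (Suc m) = P * (x + 2 * real m + 3)"
    by (simp add: P_def Suc pochhammer_Suc algebra_simps)
  have 2: "pochhammer (x - 1 + real (Suc k) + 1) (Suc m) = (x + real m + 2) * P"
    by (simp add: P_def Suc pochhammer_rec algebra_simps)
  have 3: "pochhammer (x + 1 + real k + 1) m = P"
    by (simp add: P_def Suc algebra_simps)
  have f: "fact (Suc k) = (real m + 2) * fact k"
    by (simp add: Suc algebra_simps)
  have "hagen_rothe_coeff (Suc k) x - hagen_rothe_coeff (Suc k) (x - 1)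
      = P * (x * (x + 2 * real m + 3) - (x - 1) * (x + real m + 2)) / fact (Suc k)"
    unfolding hagen_rothe_coeff_def using 1 2 Suc
    by (simp add: diff_divide_distrib right_diff_distrib mult_ac del: fact_Suc)
  also have "x * (x + 2 * real m + 3) - (x - 1) * (x + real m + 2) = (real m + 2) * (x + 1)"
    by (simp add: algebra_simps)
  also have "P * ((real m + 2) * (x + 1)) / fact (Suc k) = (x + 1) * P / fact k"
  proof -
    have "real m + 2 \<noteq> 0" by linarith
    then show ?thesis unfolding f by (simp add: mult_ac del: fact_Suc)
  qed
  also have "\<dots> = hagen_rothe_coeff k (x + 1)"
    unfolding hagen_rothe_coeff_def using 3 Suc by simp
  finally show ?thesis .
qed

lemma hagen_rothe_coeff_zero: "hagen_rothe_coeff k 0 = (if k = 0 then 1 else 0)"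
  by (simp add: hagen_rothe_coeff_def)

lemma pochhammer_shift_poly: "\<exists>p. \<forall>x. pochhammer (x + c) n = poly p (x :: real)"
proof (induction n)
  case 0
  show ?case by (intro exI[of _ "[:1:]"]) simp
next
  case (Suc n)
  then obtain p where "\<And>x. pochhammer (x + c) n = poly p x" by blast
  then show ?case
    by (intro exI[of _ "p * [:c + real n, 1:]"]) (simp add: pochhammer_Suc algebra_simps)
qed

text \<open>Periodicity settles the identity only at natural x; being polynomial in x extends it to
  real x.\<close>

lemma hagen_rothe_coeff_poly: "\<exists>p. \<forall>x. hagen_rothe_coeff k x = poly p x"
proof (cases "k = 0")
  case True
  then show ?thesis by (intro exI[of _ "[:1:]"]) (simp add: hagen_rothe_coeff_def)
next
  case False
  obtain p where "\<And>x. pochhammer (x + (real k + 1)) (k - 1) = poly p x"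
    using pochhammer_shift_poly by blast
  with False show ?thesis
    by (intro exI[of _ "smult (1 / fact k) ([:0, 1:] * p)"])
      (simp add: hagen_rothe_coeff_def add.assoc)
qed

lemma poly_eq_zero_if_zero_on_nats:
  fixes p :: "real poly"
  assumes "\<And>n :: nat. poly p (real n) = 0"
  shows "p = 0"
proof (rule ccontr)
  assume "p \<noteq> 0"
  then have "finite {x. poly p x = 0}" by (rule poly_roots_finite)
  moreover have "range real \<subseteq> {x. poly p x = 0}" using assms by auto
  moreover have "infinite (range real)" by (simp add: finite_image_iff inj_on_def)
  ultimately show False using finite_subset by blast
qed

text \<open>By \<open>hagen_rothe_coeff_step\<close> and induction on \<open>n\<close>, the difference of the two sides is a
  polynomial in \<open>x\<close> of period \<open>1\<close>, and it vanishes at \<open>x = 0\<close>.\<close>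

theorem hagen_rothe:
  "(\<Sum>k\<le>n. hagen_rothe_coeff k x * hagen_rothe_coeff (n - k) y) = hagen_rothe_coeff n (x + y)"
\<comment> \<open>The difference in x at level \<open>Suc n\<close> reduces to level n at the
  shifted point x + 1, so x must vary.\<close>
proof (induction n arbitrary: x)
  case 0
  show ?case by (simp add: hagen_rothe_coeff_def)
next
  case (Suc n)
  define D where "D x = (\<Sum>k\<le>Suc n. hagen_rothe_coeff k x * hagen_rothe_coeff (Suc n - k) y)
      - hagen_rothe_coeff (Suc n) (x + y)" for x
  have per: "D x = D (x - 1)" for x
  proof -
    have "D x - D (x - 1)
        = (\<Sum>k\<le>Suc n. (hagen_rothe_coeff k x - hagen_rothe_coeff k (x - 1))
              * hagen_rothe_coeff (Suc n - k) y)
          - (hagen_rothe_coeff (Suc n) (x + y) - hagen_rothe_coeff (Suc n) (x + y - 1))"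
      unfolding D_def by (simp only: left_diff_distrib sum_subtractf) (simp add: algebra_simps)
    also have "(\<Sum>k\<le>Suc n. (hagen_rothe_coeff k x - hagen_rothe_coeff k (x - 1))
              * hagen_rothe_coeff (Suc n - k) y)
        = (\<Sum>k\<le>n. (hagen_rothe_coeff (Suc k) x - hagen_rothe_coeff (Suc k) (x - 1))
              * hagen_rothe_coeff (n - k) y)"
      by (subst sum.atMost_Suc_shift) (simp add: hagen_rothe_coeff_def)
    also have "\<dots> = (\<Sum>k\<le>n. hagen_rothe_coeff k (x + 1) * hagen_rothe_coeff (n - k) y)"
      by (simp only: hagen_rothe_coeff_step)
    also have "\<dots> = hagen_rothe_coeff n (x + y + 1)"
      by (simp add: Suc.IH add_ac)
    finally show ?thesis by (simp add: hagen_rothe_coeff_step)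
  qed
  have D0: "D 0 = 0"
    unfolding D_def by (subst sum.atMost_Suc_shift) (simp add: hagen_rothe_coeff_zero)
  have Dn: "D (real m) = 0" for m
    by (induction m) (use D0 per[of "1 + real m" for m] in auto)
  obtain P where P: "\<And>k x. hagen_rothe_coeff k x = poly (P k) x"
    using hagen_rothe_coeff_poly by metis
  define Q where
    "Q = (\<Sum>k\<le>Suc n. smult (hagen_rothe_coeff (Suc n - k) y) (P k)) - pcompose (P (Suc n)) [:y, 1:]"
  have Q: "D x = poly Q x" for x
    unfolding D_def Q_def by (simp add: P poly_sum poly_pcompose add_ac mult.commute)
  have "Q = 0" by (rule poly_eq_zero_if_zero_on_nats) (use Q Dn in auto)
  then have "D x = 0" by (simp add: Q)
  then show ?case by (simp add: D_def)
qed

section \<open>Normalized Bessel functions\<close>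

lemma pochhammer_Gamma_pos: "x > 0 \<Longrightarrow> Gamma (x + real k) = pochhammer x k * Gamma x"
proof -
  assume x: "x > 0"
  then have "x \<notin> \<int>\<^sub>\<le>\<^sub>0" by (auto elim!: nonpos_Ints_cases)
  then show ?thesis using Gamma_real_pos[OF x] by (simp add: pochhammer_Gamma)
qed

text \<open>The function \<open>bessel_norm v\<close> is the normalized Bessel function: its value at \<open>- x\<^sup>2 / 4\<close> is
  \<open>Gamma (v + 1) (2 / x) powr v * Bessel_J v x\<close>.\<close>

definition bessel_coeff :: "real \<Rightarrow> nat \<Rightarrow> real" where
  "bessel_coeff v k = 1 / (fact k * pochhammer (v + 1) k)"

definition bessel_norm :: "real \<Rightarrow> real \<Rightarrow> real" where
  "bessel_norm v y = (\<Sum>k. bessel_coeff v k * y ^ k)"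

lemma bessel_coeff_nonneg: "v > -1 \<Longrightarrow> bessel_coeff v k \<ge> 0"
  by (simp add: bessel_coeff_def pochhammer_nonneg)

text \<open>Only the first factor can lie below 1, and the bound 1 covers the empty product. Hence
  \<open>bessel_coeff v k\<close> is at most a constant times 1 / k! for every v > -1, and
  comparison with the exponential series applies.\<close>

lemma pochhammer_ge_min:
  assumes "x > (0 :: real)"
  shows "pochhammer x k \<ge> min 1 x"
proof (induction k)
  case (Suc k)
  have "pochhammer (x + 1) k \<ge> 1"
    unfolding pochhammer_prod using assms by (intro prod_ge_1) auto
  then have "x * 1 \<le> x * pochhammer (x + 1) k"
    using assms by (intro mult_left_mono) auto
  then show ?case by (simp add: pochhammer_rec)
qed auto

lemma summable_bessel_coeff:
  assumes "v > -1"
  shows "summable (\<lambda>k. norm (bessel_coeff v k * y ^ k :: real))"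
proof (rule summable_comparison_test)
  let ?m = "min 1 (v + 1)"
  show "summable (\<lambda>k. (1 / ?m) * (inverse (fact k) * \<bar>y\<bar> ^ k))"
    by (intro summable_mult summable_exp)
  have "norm (bessel_coeff v k * y ^ k) \<le> (1 / ?m) * (inverse (fact k) * \<bar>y\<bar> ^ k)" for k
  proof -
    have p: "?m > 0" and q: "pochhammer (v + 1) k \<ge> ?m"
      using assms pochhammer_ge_min[of "v + 1" k] by auto
    then have "bessel_coeff v k \<le> (1 / ?m) * inverse (fact k)"
      unfolding bessel_coeff_def
      by (auto simp: field_simps simp del: min_less_iff_conj min.bounded_iff)
    then have "bessel_coeff v k * \<bar>y\<bar> ^ k \<le> (1 / ?m) * inverse (fact k) * \<bar>y\<bar> ^ k"
      by (rule mult_right_mono) simp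
    then show ?thesis
      using bessel_coeff_nonneg[OF assms, of k]
      by (simp add: abs_mult power_abs mult_ac)
  qed
  then show "\<exists>N. \<forall>k\<ge>N. norm (norm (bessel_coeff v k * y ^ k)) \<le> (1 / ?m) * (inverse (fact k) * \<bar>y\<bar> ^ k)"
    by (simp only: real_norm_def abs_idempotent) blast
qed

lemma bessel_norm_sums:
  assumes "v > -1"
  shows "(\<lambda>k. bessel_coeff v k * y ^ k) sums bessel_norm v y"
  unfolding bessel_norm_def
  by (rule summable_sums[OF summable_norm_cancel[OF summable_bessel_coeff[OF assms]]])

lemma bessel_norm_nonneg: "v > -1 \<Longrightarrow> y \<ge> 0 \<Longrightarrow> bessel_norm v y \<ge> 0"
  by (rule sums_le[OF _ sums_zero bessel_norm_sums]) (auto simp: bessel_coeff_nonneg)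

lemma Bessel_J_eq_bessel_norm:
  assumes "v > -1" "x > 0"
  shows "2 powr v * Gamma (v + 1) / x powr v * Bessel_J v x = bessel_norm v (- (x\<^sup>2 / 4))"
proof -
  have G: "Gamma (v + 1) > 0" using assms by (intro Gamma_real_pos) auto
  let ?C = "(x / 2) powr v / Gamma (v + 1)"
  have "(-1) ^ k * (x / 2) powr (2 * real k + v) * (1 / (fact k * Gamma (real k + v + 1)))
     = ?C * (bessel_coeff v k * (- (x\<^sup>2 / 4)) ^ k)" for k
  proof -
    have "Gamma (real k + v + 1) = pochhammer (v + 1) k * Gamma (v + 1)"
      using pochhammer_Gamma_pos[of "v + 1" k] assms by (simp add: add_ac)
    moreover have "(x / 2) powr (2 * real k + v) = (x\<^sup>2 / 4) ^ k * (x / 2) powr v"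
    proof -
      have "(x / 2) powr (2 * real k) = (x / 2) ^ (2 * k)"
        using assms powr_realpow[of "x / 2" "2 * k"] by simp
      then show ?thesis by (simp add: powr_add power_mult power_divide)
    qed
    ultimately show ?thesis
      using power_mult_distrib[of "- 1" "x\<^sup>2 / 4" k]
      by (simp add: bessel_coeff_def mult_ac)
  qed
  then have "Bessel_J v x = ?C * bessel_norm v (- (x\<^sup>2 / 4))"
    unfolding Bessel_J_def bessel_norm_def
    by (simp only: suminf_mult[OF sums_summable[OF bessel_norm_sums[OF assms(1)]]])
  then show ?thesis
    using assms G by (simp add: powr_divide less_imp_neq[THEN not_sym])
qed

text \<open>The condition on the order \<open>v\<close> as a function of the Dirichlet parameter that makes
  \<open>bessel_kernel v x\<close> below a convolution semigroup in its parameter: it compares coefficients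
  after termwise Beta integrals. The density \<open>f\<^sub>1\<close> leads to \<open>v x = (x - 1) / 2\<close>, where the
  condition is Vandermonde's identity, and \<open>f\<^sub>2\<close> leads to \<open>v x = x\<close>, where it is the
  Hagen-Rothe identity.\<close>

definition bessel_family :: "(real \<Rightarrow> real) \<Rightarrow> bool" where
  "bessel_family v \<longleftrightarrow> (\<forall>x>0. v x > -1) \<and>
     (\<forall>x>0. \<forall>y>0. \<forall>n.
       (\<Sum>k\<le>n. (pochhammer x (2 * k) * bessel_coeff (v x) k)
              * (pochhammer y (2 * (n - k)) * bessel_coeff (v y) (n - k)))
       = pochhammer (x + y) (2 * n) * bessel_coeff (v (x + y)) n)"

text \<open>For order x the denominator of \<open>bessel_coeff x k\<close> contains exactly the
  middle block \<open>pochhammer (x + 1) k\<close> of \<open>pochhammer x (2 * k)\<close>.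
  Cancelling it leaves \<open>hagen_rothe_coeff k x\<close>.\<close>

lemma bessel_family_id: "bessel_family (\<lambda>x. x)"
proof -
  have "pochhammer x (2 * k) * bessel_coeff x k = hagen_rothe_coeff k x" if "x > 0" for x k
  proof (cases k)
    case (Suc m)
    have "pochhammer x (2 * k) = x * pochhammer (x + 1) (k + m)"
      by (simp add: Suc pochhammer_rec mult_2)
    also have "\<dots> = x * (pochhammer (x + 1) k * pochhammer (x + 1 + real k) m)"
      by (simp only: pochhammer_product')
    finally show ?thesis
      using pochhammer_pos[of "x + 1" k] that Suc
      by (simp add: bessel_coeff_def hagen_rothe_coeff_def add_ac)
  qed (simp add: bessel_coeff_def hagen_rothe_coeff_def)
  then show ?thesis
    unfolding bessel_family_def using hagen_rothe by simp
qed

text \<open>The duplication formula splits \<open>pochhammer x (2 * k)\<close> into 4^k times the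
  symbols at x / 2 and x / 2 + 1 / 2. The order (x - 1) / 2 makes the second one cancel, which
  leaves the coefficients of (1 - 4 z)^(-x / 2).\<close>

lemma bessel_family_half: "bessel_family (\<lambda>x. (x - 1) / 2)"
proof -
  have *: "pochhammer x (2 * k) * bessel_coeff ((x - 1) / 2) k = 4 ^ k * pochhammer (x / 2) k / fact k"
    if "x > 0" for x :: real and k
  proof -
    have e: "(x - 1) / 2 + 1 = x / 2 + 1 / 2" by (simp add: field_simps)
    have "pochhammer (x / 2 + 1 / 2) k > 0" using that by (intro pochhammer_pos) auto
    then show ?thesis
      using pochhammer_double[of "x / 2" k] unfolding bessel_coeff_def e
      by (simp add: power_mult)
  qed
  have "(\<Sum>k\<le>n. 4 ^ k * pochhammer (x / 2) k / fact k * (4 ^ (n - k) * pochhammer (y / 2) (n - k) / fact (n - k)))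
      = 4 ^ n * pochhammer ((x + y) / 2) n / fact n" for x y :: real and n
  proof -
    have "4 ^ k * pochhammer (x / 2) k / fact k * (4 ^ (n - k) * pochhammer (y / 2) (n - k) / fact (n - k))
      = 4 ^ n / fact n * (of_nat (n choose k) * pochhammer (x / 2) k * pochhammer (y / 2) (n - k))"
      if "k \<le> n" for k
      using that power_add[of "4 :: real" k "n - k"] by (simp add: binomial_fact field_simps)
    then have "(\<Sum>k\<le>n. 4 ^ k * pochhammer (x / 2) k / fact k * (4 ^ (n - k) * pochhammer (y / 2) (n - k) / fact (n - k)))
        = (\<Sum>k\<le>n. 4 ^ n / fact n * (of_nat (n choose k) * pochhammer (x / 2) k * pochhammer (y / 2) (n - k)))"
      by (intro sum.cong) auto
    then show ?thesis
      unfolding add_divide_distrib[of x y] pochhammer_binomial_sum sum_distrib_left[symmetric] by simp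
  qed
  then show ?thesis
    unfolding bessel_family_def by (intro conjI allI impI) (simp, simp only: * add_pos_pos)
qed

section \<open>Convolution of Bessel kernels\<close>

lemma nn_integral_beta_convolution:
  fixes p q u :: real
  assumes "p > 0" "q > 0" "u > 0"
  shows "(\<integral>\<^sup>+s. ennreal (s powr (p - 1) * (u - s) powr (q - 1)) * indicator {0<..<u} s \<partial>lborel)
    = ennreal (Gamma p * Gamma q / Gamma (p + q) * u powr (p + q - 1))"
proof -
  \<comment> \<open>The shape \<open>0 + u * s\<close> is what the affine substitution with shift 0
    and scale u produces; it maps the unit interval onto (0, u).\<close>
  have eq: "ennreal ((0 + u * s) powr (p - 1) * (u - (0 + u * s)) powr (q - 1)) * indicator {0<..<u} (0 + u * s)
      = ennreal (u powr (p + q - 2)) * (ennreal (s powr (p - 1) * (1 - s) powr (q - 1)) * indicator {0<..<1} s)" for s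
  proof (cases "0 < s \<and> s < 1")
    case True
    have "u - u * s = u * (1 - s)" by (simp add: algebra_simps)
    moreover have "u powr (p + q - 2) = u powr (p - 1) * u powr (q - 1)"
      by (simp add: powr_add[symmetric])
    ultimately show ?thesis
      using True assms by (simp add: powr_mult ennreal_mult'[symmetric] mult_ac)
  next
    case False
    then have "\<not> (0 < u * s \<and> u * s < u)"
      using assms by (auto simp: zero_less_mult_iff)
    with False show ?thesis by (auto simp: indicator_def)
  qed
  have "((\<lambda>s. s powr (p - 1) * (1 - s) powr (q - 1)) has_integral Beta p q) {0<..<1}"
    using has_integral_Beta_real[OF assms(1,2)] by (simp add: has_integral_Icc_iff_Ioo)
  then have B: "(\<integral>\<^sup>+s. ennreal (s powr (p - 1) * (1 - s) powr (q - 1)) * indicator {0<..<1} s \<partial>lborel)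
      = ennreal (Beta p q)"
    by (intro nn_integral_has_integral_lebesgue') auto
  have "(\<integral>\<^sup>+s. ennreal (s powr (p - 1) * (u - s) powr (q - 1)) * indicator {0<..<u} s \<partial>lborel)
      = ennreal u * (ennreal (u powr (p + q - 2)) * ennreal (Beta p q))"
    using assms
    by (subst nn_integral_real_affine[where c = u and t = 0])
      (simp_all only: eq, simp_all add: nn_integral_cmult B)
  also have "\<dots> = ennreal (Beta p q * (u powr 1 * u powr (p + q - 2)))"
    using assms Gamma_real_pos[of p] Gamma_real_pos[of q] Gamma_real_pos[of "p + q"]
    by (simp add: Beta_def ennreal_mult'[symmetric] mult_ac)
  also have "u powr 1 * u powr (p + q - 2) = u powr (p + q - 1)"
    by (subst powr_add[symmetric]) (simp add: algebra_simps)
  finally show ?thesis by (simp add: Beta_def)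
qed

text \<open>The cutoff at 0 confines a convolution over the whole line to 0 < s < u and also encodes
  the simplex on which the durations live. The factor 1 / \<open>Gamma l\<close> makes the semigroup
  law hold without constants.\<close>

definition bessel_kernel :: "(real \<Rightarrow> real) \<Rightarrow> real \<Rightarrow> real \<Rightarrow> real \<Rightarrow> real" where
  "bessel_kernel v x l s =
     (if s > 0 then s powr (l - 1) / Gamma l * bessel_norm (v l) (x * s\<^sup>2) else 0)"

lemma measurable_bessel_kernel [measurable]: "bessel_kernel v x l \<in> borel_measurable borel"
  unfolding bessel_kernel_def[abs_def] bessel_norm_def by measurable

lemma bessel_familyD:
  assumes "bessel_family v" "x > 0"
  shows "v x > -1"
  using assms by (simp add: bessel_family_def)

lemma bessel_kernel_nonneg:
  assumes "bessel_family v" "l > 0" "x \<ge> 0"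
  shows "bessel_kernel v x l s \<ge> 0"
  unfolding bessel_kernel_def using assms
  by (auto intro!: mult_nonneg_nonneg divide_nonneg_pos bessel_norm_nonneg Gamma_real_pos
      intro: bessel_familyD)

lemma powr_mult_even_power:
  "s > 0 \<Longrightarrow> s powr (l - 1) * (s\<^sup>2) ^ k = s powr (l + 2 * real k - 1)" for s :: real
proof -
  assume "s > 0"
  then have "s powr (l - 1) * (s\<^sup>2) ^ k = s powr (l - 1) * s powr (2 * real k)"
    using powr_realpow[of s "2 * k"] by (simp add: power_mult[symmetric])
  also have "\<dots> = s powr (l + 2 * real k - 1)"
    by (subst powr_add[symmetric]) (simp add: algebra_simps)
  finally show ?thesis .
qed

lemma bessel_kernel_sums:
  assumes "bessel_family v" "l > 0" "s > 0"
  shows "(\<lambda>k. bessel_coeff (v l) k / Gamma l * x ^ k * s powr (l + 2 * real k - 1)) sums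
    bessel_kernel v x l s"
    and "summable (\<lambda>k. norm (bessel_coeff (v l) k / Gamma l * x ^ k * s powr (l + 2 * real k - 1)))"
proof -
  let ?c = "s powr (l - 1) / Gamma l"
  have eq: "bessel_coeff (v l) k / Gamma l * x ^ k * s powr (l + 2 * real k - 1)
      = ?c * (bessel_coeff (v l) k * (x * s\<^sup>2) ^ k)" for k
    unfolding powr_mult_even_power[OF assms(3), symmetric] by (simp add: power_mult_distrib)
  have v: "v l > -1" using assms by (auto intro: bessel_familyD)
  show "(\<lambda>k. bessel_coeff (v l) k / Gamma l * x ^ k * s powr (l + 2 * real k - 1)) sums
    bessel_kernel v x l s"
    unfolding eq using assms(3) sums_mult[OF bessel_norm_sums[OF v], of ?c "x * s\<^sup>2"]
    by (simp only: bessel_kernel_def if_True)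
  show "summable (\<lambda>k. norm (bessel_coeff (v l) k / Gamma l * x ^ k * s powr (l + 2 * real k - 1)))"
    unfolding eq norm_mult[of ?c] by (rule summable_mult[OF summable_bessel_coeff[OF v]])
qed

text \<open>The Cauchy product of the two kernel series has nonnegative terms and may be integrated
  termwise, each term being a Beta integral. The quotients of Gamma values at l + 2 k and l become
  \<open>pochhammer l (2 * k)\<close>, so the n-th coefficient is exactly the sum in
  \<open>bessel_family\<close>.\<close>

theorem nn_integral_bessel_kernel_convolution:
  assumes v: "bessel_family v" and l: "l > 0" "m > 0" and x: "x \<ge> 0"
  shows "(\<integral>\<^sup>+s. ennreal (bessel_kernel v x l s) * ennreal (bessel_kernel v x m (u - s)) \<partial>lborel)
    = ennreal (bessel_kernel v x (l + m) u)"
proof (cases "u > 0")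
  case False
  then have "ennreal (bessel_kernel v x l s) * ennreal (bessel_kernel v x m (u - s)) = 0" for s
    by (cases "s > 0") (auto simp: bessel_kernel_def)
  then have "(\<integral>\<^sup>+s. ennreal (bessel_kernel v x l s) * ennreal (bessel_kernel v x m (u - s)) \<partial>lborel) = 0"
    by (simp only: nn_integral_const mult_zero_left)
  with False show ?thesis by (simp add: bessel_kernel_def)
next
  case True
  define A where "A l k = bessel_coeff (v l) k / Gamma l * x ^ k" for l k
  have A: "A l k \<ge> 0" if "l > 0" for l k
    unfolding A_def using that x Gamma_real_pos[of l] bessel_familyD[OF v]
    by (auto intro!: mult_nonneg_nonneg divide_nonneg_pos bessel_coeff_nonneg)
  define P where "P k n s = s powr (l + 2 * real k - 1) * (u - s) powr (m + 2 * real (n - k) - 1)" for k n s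
  have P: "P k n s \<ge> 0" for k n s by (simp add: P_def)
  have [measurable]: "P k n \<in> borel_measurable borel" for k n unfolding P_def by measurable
  have AAP: "A l k * A m (n - k) * P k n s \<ge> 0" for k n s
    using A l P by simp
  have 1: "ennreal (bessel_kernel v x l s) * ennreal (bessel_kernel v x m (u - s))
      = (\<Sum>n. \<Sum>k\<le>n. ennreal (A l k * A m (n - k)) * (ennreal (P k n s) * indicator {0<..<u} s))" for s
  proof (cases "0 < s \<and> s < u")
    case in_range: True
    have "(\<lambda>n. \<Sum>k\<le>n. (A l k * s powr (l + 2 * real k - 1)) * (A m (n - k) * (u - s) powr (m + 2 * real (n - k) - 1)))
        sums (bessel_kernel v x l s * bessel_kernel v x m (u - s))"
      using Cauchy_product_sums[OF bessel_kernel_sums(2)[OF v l(1), of s x] bessel_kernel_sums(2)[OF v l(2), of "u - s" x]]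
        in_range bessel_kernel_sums(1)[OF v l(1), of s x] bessel_kernel_sums(1)[OF v l(2), of "u - s" x]
      by (simp only: A_def[symmetric] sums_iff) simp
    then have "(\<lambda>n. \<Sum>k\<le>n. A l k * A m (n - k) * P k n s) sums (bessel_kernel v x l s * bessel_kernel v x m (u - s))"
      by (simp add: P_def mult_ac)
    then have "(\<Sum>n. ennreal (\<Sum>k\<le>n. A l k * A m (n - k) * P k n s))
        = ennreal (bessel_kernel v x l s * bessel_kernel v x m (u - s))"
      by (intro suminf_ennreal_eq sum_nonneg AAP)
    then show ?thesis
      using in_range A[OF l(1)] A[OF l(2)] P bessel_kernel_nonneg[OF v l(1) x] AAP
      by (simp add: ennreal_mult'[symmetric] sum_ennreal)
  next
    case False
    then show ?thesis by (auto simp: bessel_kernel_def indicator_def)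
  qed
  have int: "(\<integral>\<^sup>+s. ennreal (P k n s) * indicator {0<..<u} s \<partial>lborel)
      = ennreal (Gamma (l + 2 * real k) * Gamma (m + 2 * real (n - k)) / Gamma (l + m + 2 * real n)
          * u powr (l + m + 2 * real n - 1))" if "k \<le> n" for k n
    using nn_integral_beta_convolution[of "l + 2 * real k" "m + 2 * real (n - k)" u] l True that
    by (simp add: P_def of_nat_diff algebra_simps)
  have 2: "(\<integral>\<^sup>+s. (\<Sum>k\<le>n. ennreal (A l k * A m (n - k)) * (ennreal (P k n s) * indicator {0<..<u} s)) \<partial>lborel)
      = ennreal (A (l + m) n * u powr (l + m + 2 * real n - 1))" for n
  proof -
    have "(\<integral>\<^sup>+s. (\<Sum>k\<le>n. ennreal (A l k * A m (n - k)) * (ennreal (P k n s) * indicator {0<..<u} s)) \<partial>lborel)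
        = (\<Sum>k\<le>n. ennreal (A l k * A m (n - k)) * ennreal (Gamma (l + 2 * real k) * Gamma (m + 2 * real (n - k)) / Gamma (l + m + 2 * real n)
          * u powr (l + m + 2 * real n - 1)))"
      by (subst nn_integral_sum) (auto simp: nn_integral_cmult int intro!: sum.cong)
    also have "\<dots> = ennreal (\<Sum>k\<le>n. A l k * A m (n - k) * (Gamma (l + 2 * real k) * Gamma (m + 2 * real (n - k)) / Gamma (l + m + 2 * real n)
          * u powr (l + m + 2 * real n - 1)))"
      using A l by (subst sum_ennreal[symmetric])
        (auto simp: ennreal_mult'[symmetric] intro!: mult_nonneg_nonneg divide_nonneg_pos Gamma_real_pos less_imp_le[OF Gamma_real_pos] add_pos_nonneg)
    also have "(\<Sum>k\<le>n. A l k * A m (n - k) * (Gamma (l + 2 * real k) * Gamma (m + 2 * real (n - k)) / Gamma (l + m + 2 * real n)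
          * u powr (l + m + 2 * real n - 1)))
        = (\<Sum>k\<le>n. (pochhammer l (2 * k) * bessel_coeff (v l) k) * (pochhammer m (2 * (n - k)) * bessel_coeff (v m) (n - k)))
          * (x ^ n / Gamma (l + m + 2 * real n) * u powr (l + m + 2 * real n - 1))"
      unfolding sum_distrib_right
    proof (intro sum.cong refl)
      fix k assume "k \<in> {..n}"
      then have "x ^ k * x ^ (n - k) = x ^ n" by (simp add: power_add[symmetric])
      moreover have "Gamma (l + 2 * real k) = pochhammer l (2 * k) * Gamma l"
          "Gamma (m + 2 * real (n - k)) = pochhammer m (2 * (n - k)) * Gamma m"
        using pochhammer_Gamma_pos[OF l(1), of "2 * k"] pochhammer_Gamma_pos[OF l(2), of "2 * (n - k)"]
        by simp_all
      ultimately show "A l k * A m (n - k) * (Gamma (l + 2 * real k) * Gamma (m + 2 * real (n - k)) / Gamma (l + m + 2 * real n)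
          * u powr (l + m + 2 * real n - 1)) = (pochhammer l (2 * k) * bessel_coeff (v l) k) * (pochhammer m (2 * (n - k)) * bessel_coeff (v m) (n - k))
          * (x ^ n / Gamma (l + m + 2 * real n) * u powr (l + m + 2 * real n - 1))"
        using Gamma_real_pos[OF l(1)] Gamma_real_pos[OF l(2)]
        by (simp add: A_def mult_ac)
    qed
    also have "(\<Sum>k\<le>n. (pochhammer l (2 * k) * bessel_coeff (v l) k) * (pochhammer m (2 * (n - k)) * bessel_coeff (v m) (n - k)))
        = pochhammer (l + m) (2 * n) * bessel_coeff (v (l + m)) n"
      using v l by (simp add: bessel_family_def)
    also have "pochhammer (l + m) (2 * n) * bessel_coeff (v (l + m)) n * (x ^ n / Gamma (l + m + 2 * real n) * u powr (l + m + 2 * real n - 1))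
        = A (l + m) n * u powr (l + m + 2 * real n - 1)"
      using l pochhammer_Gamma_pos[of "l + m" "2 * n"] pochhammer_pos[of "l + m" "2 * n"]
      by (simp add: A_def)
    finally show ?thesis .
  qed
  have "(\<integral>\<^sup>+s. ennreal (bessel_kernel v x l s) * ennreal (bessel_kernel v x m (u - s)) \<partial>lborel)
      = (\<Sum>n. ennreal (A (l + m) n * u powr (l + m + 2 * real n - 1)))"
    unfolding 1 by (subst nn_integral_suminf) (auto simp: 2)
  also have "\<dots> = ennreal (bessel_kernel v x (l + m) u)"
  proof (rule suminf_ennreal_eq)
    show "A (l + m) n * u powr (l + m + 2 * real n - 1) \<ge> 0" for n
      using A[of "l + m" n] l by simp
    show "(\<lambda>n. A (l + m) n * u powr (l + m + 2 * real n - 1)) sums bessel_kernel v x (l + m) u"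
      using bessel_kernel_sums(1)[OF v, of "l + m" u x] l True unfolding A_def by simp
  qed
  finally show ?thesis .
qed

interpretation lborel_product: product_sigma_finite "\<lambda>_ :: nat. lborel :: real measure"
  by standard

text \<open>The cutoff in the kernel makes this an (n + 1)-fold convolution evaluated at u.
  Splitting off the coordinate \<open>Suc n\<close> with value s leaves the same integral at u - s,
  which is why u is arbitrary in the induction.\<close>

theorem nn_integral_bessel_kernel_simplex:
  assumes v: "bessel_family v" and a: "a > 0" and x: "x \<ge> 0"
  shows "(\<integral>\<^sup>+\<tau>. (\<Prod>j=1..n. ennreal (bessel_kernel v x a (\<tau> j)))
              * ennreal (bessel_kernel v x a (u - (\<Sum>j=1..n. \<tau> j))) \<partial>PiM {1..n} (\<lambda>_. lborel))
    = ennreal (bessel_kernel v x (real (n + 1) * a) u)"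
proof (induction n arbitrary: u)
  case 0
  show ?case using lborel_product.nn_integral_empty[of "\<lambda>_. ennreal (bessel_kernel v x a u)"] by simp
next
  case (Suc n)
  let ?K = "bessel_kernel v x a"
  let ?I = "\<lambda>u. \<integral>\<^sup>+\<tau>. (\<Prod>j=1..n. ennreal (?K (\<tau> j))) * ennreal (?K (u - (\<Sum>j=1..n. \<tau> j))) \<partial>PiM {1..n} (\<lambda>_. lborel)"
  let ?f = "\<lambda>\<tau>. (\<Prod>j=1..Suc n. ennreal (?K (\<tau> j))) * ennreal (?K (u - (\<Sum>j=1..Suc n. \<tau> j)))"
  have ins: "{1..Suc n} = insert (Suc n) {1..n}" by auto
  have "(\<integral>\<^sup>+\<tau>. ?f \<tau> \<partial>PiM {1..Suc n} (\<lambda>_. lborel))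
      = (\<integral>\<^sup>+s. \<integral>\<^sup>+\<tau>. ?f (\<tau>(Suc n := s)) \<partial>PiM {1..n} (\<lambda>_. lborel) \<partial>lborel)"
    unfolding ins by (subst lborel_product.product_nn_integral_insert_rev) auto
  also have "\<dots> = (\<integral>\<^sup>+s. ennreal (?K s) * ?I (u - s) \<partial>lborel)"
  proof (intro nn_integral_cong)
    fix s :: real
    have "?f (\<tau>(Suc n := s)) = ennreal (?K s) * ((\<Prod>j=1..n. ennreal (?K (\<tau> j))) * ennreal (?K (u - s - (\<Sum>j=1..n. \<tau> j))))" for \<tau>
    proof -
      have "(\<Prod>j=1..n. ennreal (?K ((\<tau>(Suc n := s)) j))) = (\<Prod>j=1..n. ennreal (?K (\<tau> j)))"
        "(\<Sum>j=1..n. (\<tau>(Suc n := s)) j) = (\<Sum>j=1..n. \<tau> j)"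
        by (auto intro!: prod.cong sum.cong)
      then show ?thesis by (simp add: algebra_simps)
    qed
    then show "(\<integral>\<^sup>+\<tau>. ?f (\<tau>(Suc n := s)) \<partial>PiM {1..n} (\<lambda>_. lborel)) = ennreal (?K s) * ?I (u - s)"
      by (simp only:) (subst nn_integral_cmult, auto)
  qed
  also have "\<dots> = (\<integral>\<^sup>+s. ennreal (?K s) * ennreal (bessel_kernel v x (real (n + 1) * a) (u - s)) \<partial>lborel)"
    by (simp only: Suc.IH)
  also have "\<dots> = ennreal (bessel_kernel v x (a + real (n + 1) * a) u)"
    using a by (intro nn_integral_bessel_kernel_convolution v x) auto
  also have "a + real (n + 1) * a = real (Suc n + 1) * a" by (simp add: algebra_simps)
  finally show ?case .
qed

section \<open>Moment generating and characteristic functions\<close>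

text \<open>Zeros are isolated: a nonzero coefficient of positive index in the difference series
  would make its sum nonzero on a punctured ball around 0. Index 0 is read off at x = 0.\<close>

lemma powser_unique_real:
  fixes a b :: "nat \<Rightarrow> real"
  assumes "\<And>x. (\<lambda>n. a n * x ^ n) sums f x" "\<And>x. (\<lambda>n. b n * x ^ n) sums f x"
  shows "a = b"
proof
  fix m
  have s: "(\<lambda>n. (a n - b n) * x ^ n) sums 0" for x
    using sums_diff[OF assms(1)[of x] assms(2)[of x]] by (simp add: left_diff_distrib)
  show "a m = b m"
  proof (cases "m = 0")
    case True
    with s[of 0] show ?thesis by simp
  next
    case False
    show ?thesis
    proof (rule ccontr)
      assume "a m \<noteq> b m"
      then obtain r where "r > 0" "\<And>x. x \<in> cball (0 :: real) r - {0} \<Longrightarrow> (\<lambda>_. 0 :: real) x \<noteq> 0"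
        using powser_0_nonzero[of 1 "0 :: real" "\<lambda>n. a n - b n" "\<lambda>_. 0" m] s False by auto
      then have "r \<notin> cball (0 :: real) r - {0}" by blast
      with \<open>r > 0\<close> show False by simp
    qed
  qed
qed

text \<open>The bound R dominates the terms of the exponential series by those of exp(|z| R), which
  justifies the interchange. The type of z is left open so that real arguments give the moment
  generating function and z = \<i> the characteristic function, with the same moments.\<close>

lemma (in prob_space) exp_moments_sums:
  fixes Z :: "'a \<Rightarrow> real" and z :: "'b :: {real_normed_field, banach, second_countable_topology}"
  assumes Z [measurable]: "Z \<in> borel_measurable M" and bound: "AE \<omega> in M. \<bar>Z \<omega>\<bar> \<le> R"
  shows "(\<lambda>p. of_real (expectation (\<lambda>\<omega>. Z \<omega> ^ p) / fact p) * z ^ p) sums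
    expectation (\<lambda>\<omega>. exp (z * of_real (Z \<omega>)))"
proof -
  let ?t = "\<lambda>p \<omega>. (z * of_real (Z \<omega>)) ^ p /\<^sub>R fact p"
  have int_pow: "integrable M (\<lambda>\<omega>. Z \<omega> ^ p)" for p
    by (rule integrable_const_bound[where B = "R ^ p"])
      (use bound in \<open>auto elim!: eventually_mono simp: power_abs intro: power_mono\<close>)
  have t: "?t p = (\<lambda>\<omega>. (z ^ p / fact p) * of_real (Z \<omega> ^ p))" for p
    by (auto simp: fun_eq_iff scaleR_conv_of_real power_mult_distrib field_simps)
  have int: "integrable M (?t p)" for p
    unfolding t by (intro integrable_mult_right integrable_of_real int_pow)
  have le: "AE \<omega> in M. norm (?t p \<omega>) \<le> (norm z * R) ^ p /\<^sub>R fact p" for p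
    using bound
  proof eventually_elim
    case (elim \<omega>)
    then have "(norm z * \<bar>Z \<omega>\<bar>) ^ p \<le> (norm z * R) ^ p"
      by (intro power_mono mult_left_mono) auto
    then show ?case by (simp add: norm_power norm_mult divide_right_mono)
  qed
  have "(\<lambda>p. expectation (?t p)) sums expectation (\<lambda>\<omega>. \<Sum>p. ?t p \<omega>)"
  proof (rule sums_integral[OF int])
    show "AE \<omega> in M. summable (\<lambda>p. norm (?t p \<omega>))"
      by (intro AE_I2 summable_norm_exp)
    show "summable (\<lambda>p. expectation (\<lambda>\<omega>. norm (?t p \<omega>)))"
    proof (rule summable_comparison_test)
      show "summable (\<lambda>p. (norm z * R) ^ p /\<^sub>R fact p)" by (rule summable_exp_generic)
      have "norm (expectation (\<lambda>\<omega>. norm (?t p \<omega>))) \<le> (norm z * R) ^ p /\<^sub>R fact p" for p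
      proof -
        have "expectation (\<lambda>\<omega>. norm (?t p \<omega>)) \<le> expectation (\<lambda>_. (norm z * R) ^ p /\<^sub>R fact p)"
          by (intro integral_mono_AE integrable_norm int le) simp
        moreover have "expectation (\<lambda>\<omega>. norm (?t p \<omega>)) \<ge> 0" by simp
        ultimately show ?thesis by (simp add: prob_space)
      qed
      then show "\<exists>N. \<forall>p\<ge>N. norm (expectation (\<lambda>\<omega>. norm (?t p \<omega>))) \<le> (norm z * R) ^ p /\<^sub>R fact p"
        by blast
    qed
  qed
  also have "(\<lambda>p. expectation (?t p)) = (\<lambda>p. of_real (expectation (\<lambda>\<omega>. Z \<omega> ^ p) / fact p) * z ^ p)"
    unfolding t integral_mult_right_zero integral_of_real[OF int_pow] by (simp add: fun_eq_iff)
  finally show ?thesis by (simp add: exp_def)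
qed

text \<open>This matches a series in \<open>x\<^sup>2\<close> with the full moment series, in which
  the odd terms vanish.\<close>

lemma sums_even_reindex:
  fixes a :: "nat \<Rightarrow> 'b :: real_normed_field"
  shows "(\<lambda>p. (if even p then a (p div 2) else 0) * x ^ p) sums S \<longleftrightarrow> (\<lambda>k. a k * (x\<^sup>2) ^ k) sums S"
proof -
  have "(\<lambda>k. (\<lambda>p. (if even p then a (p div 2) else 0) * x ^ p) (2 * k)) sums S
      \<longleftrightarrow> (\<lambda>p. (if even p then a (p div 2) else 0) * x ^ p) sums S"
    by (rule sums_mono_reindex) (auto simp: strict_mono_def elim!: evenE)
  then show ?thesis by (simp add: power_mult)
qed

text \<open>A bounded random variable has an everywhere convergent moment series, so its moment
  generating function on the real line determines its characteristic function.\<close>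

lemma (in prob_space) char_from_mgf:
  fixes Z :: "'a \<Rightarrow> real"
  assumes "Z \<in> borel_measurable M" "AE \<omega> in M. \<bar>Z \<omega>\<bar> \<le> R"
    and "\<And>s. (\<lambda>k. a k * (s\<^sup>2) ^ k) sums expectation (\<lambda>\<omega>. exp (s * Z \<omega>))"
  shows "(\<lambda>k. complex_of_real (a k * (-1) ^ k)) sums expectation (\<lambda>\<omega>. exp (\<i> * complex_of_real (Z \<omega>)))"
proof -
  have "(\<lambda>p. expectation (\<lambda>\<omega>. Z \<omega> ^ p) / fact p) = (\<lambda>p. if even p then a (p div 2) else 0)"
  proof (rule powser_unique_real)
    show "(\<lambda>p. expectation (\<lambda>\<omega>. Z \<omega> ^ p) / fact p * s ^ p) sums expectation (\<lambda>\<omega>. exp (s * Z \<omega>))" for s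
      using exp_moments_sums[OF assms(1,2), of s] by simp
    show "(\<lambda>p. (if even p then a (p div 2) else 0) * s ^ p) sums expectation (\<lambda>\<omega>. exp (s * Z \<omega>))" for s
      unfolding sums_even_reindex by (rule assms(3))
  qed
  then have m: "expectation (\<lambda>\<omega>. Z \<omega> ^ p) / fact p = (if even p then a (p div 2) else 0)" for p
    by (rule fun_cong)
  have "(\<lambda>p. complex_of_real (if even p then a (p div 2) else 0) * \<i> ^ p) sums
      expectation (\<lambda>\<omega>. exp (\<i> * complex_of_real (Z \<omega>)))"
    using exp_moments_sums[OF assms(1,2), of "\<i>"] unfolding m .
  \<comment> \<open>Since \<open>\<i>\<^sup>2 = -1\<close>, the even powers of \<i> become the
    alternating signs.\<close>
  then show ?thesis
    using sums_even_reindex[of "\<lambda>k. complex_of_real (a k)" "\<i>"]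
    by (simp add: if_distrib[of complex_of_real] cong: if_cong)
qed

section \<open>Moments of the uniform distribution on the sphere\<close>

definition sin_cos_integral :: "nat \<Rightarrow> nat \<Rightarrow> real" where
  "sin_cos_integral a b = (\<integral>x. sin x ^ a * cos x ^ b * indicator {0..pi} x \<partial>lborel)"

lemma integrable_indicator_mult_continuous:
  fixes f :: "real \<Rightarrow> real"
  assumes "continuous_on UNIV f"
  shows "integrable lborel (\<lambda>x. f x * indicator {a..b} x)"
  using borel_integrable_atLeastAtMost'[of a b f] continuous_on_subset[OF assms]
  by (simp add: set_integrable_def mult.commute)

text \<open>Two linear equations determine both integrals: one is Pythagoras, the other integrates
  the derivative of sin^(a + 1) cos^(b + 1), which vanishes at 0 and at pi.\<close>

lemma sin_cos_integral_rec:
  "sin_cos_integral (a + 2) b = (real a + 1) / (real a + real b + 2) * sin_cos_integral a b"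
  "sin_cos_integral a (b + 2) = (real b + 1) / (real a + real b + 2) * sin_cos_integral a b"
proof -
  have int: "integrable lborel (\<lambda>x :: real. sin x ^ a * cos x ^ b * indicator {0..pi} x)" for a b
    by (intro integrable_indicator_mult_continuous continuous_intros)
  have "sin x ^ a * cos x ^ b = sin x ^ (a + 2) * cos x ^ b + sin x ^ a * cos x ^ (b + 2)" for x :: real
  proof -
    have "sin x ^ (a + 2) * cos x ^ b + sin x ^ a * cos x ^ (b + 2)
        = sin x ^ a * cos x ^ b * ((sin x)\<^sup>2 + (cos x)\<^sup>2)"
      by (simp only: power_add distrib_left mult_ac)
    then show ?thesis by simp
  qed
  then have 1: "sin_cos_integral a b = sin_cos_integral (a + 2) b + sin_cos_integral a (b + 2)"
    unfolding sin_cos_integral_def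
    by (simp only: distrib_right Bochner_Integration.integral_add[symmetric, OF int int])
  define F where "F x = sin x ^ (a + 1) * cos x ^ (b + 1)" for x :: real
  define f where "f x = (real a + 1) * (sin x ^ a * cos x ^ (b + 2))
      - (real b + 1) * (sin x ^ (a + 2) * cos x ^ b)" for x :: real
  have "DERIV F x :> f x" for x
  proof -
    have "((\<lambda>x. sin x ^ Suc a * cos x ^ Suc b) has_field_derivative
        (1 + of_nat a) * (cos x * sin x ^ a) * cos x ^ Suc b
        + (1 + of_nat b) * (- sin x * cos x ^ b) * sin x ^ Suc a) (at x)"
      by (intro DERIV_mult DERIV_power_Suc DERIV_sin DERIV_cos)
    also have "(1 + of_nat a) * (cos x * sin x ^ a) * cos x ^ Suc b
        + (1 + of_nat b) * (- sin x * cos x ^ b) * sin x ^ Suc a = f x"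
      by (simp add: f_def algebra_simps)
    finally show ?thesis unfolding F_def Suc_eq_plus1 .
  qed
  moreover have "isCont f x" for x unfolding f_def by (intro continuous_intros)
  ultimately have "(\<integral>x. f x * indicator {0..pi} x \<partial>lborel) = F pi - F 0"
    by (intro integral_FTC_Icc_real) auto
  moreover have "(\<integral>x. f x * indicator {0..pi} x \<partial>lborel)
      = (real a + 1) * sin_cos_integral a (b + 2) - (real b + 1) * sin_cos_integral (a + 2) b"
  proof -
    have "f x * indicator {0..pi} x = (real a + 1) * (sin x ^ a * cos x ^ (b + 2) * indicator {0..pi} x)
        - (real b + 1) * (sin x ^ (a + 2) * cos x ^ b * indicator {0..pi} x)" for x
      by (simp only: f_def left_diff_distrib mult.assoc)
    then show ?thesis
      by (simp only: Bochner_Integration.integral_diff[OF integrable_mult_right[OF int] integrable_mult_right[OF int]]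
        integral_mult_right_zero sin_cos_integral_def)
  qed
  ultimately have 2: "(real a + 1) * sin_cos_integral a (b + 2) = (real b + 1) * sin_cos_integral (a + 2) b"
    by (simp add: F_def)
  have pos: "real a + real b + 2 > 0" by linarith
  have "(real a + real b + 2) * sin_cos_integral (a + 2) b = (real a + 1) * sin_cos_integral a b"
    using 1 2 by (simp add: algebra_simps)
  then show "sin_cos_integral (a + 2) b = (real a + 1) / (real a + real b + 2) * sin_cos_integral a b"
    using pos by (simp add: field_simps)
  have "(real a + real b + 2) * sin_cos_integral a (b + 2) = (real b + 1) * sin_cos_integral a b"
    using 1 2 by (simp add: algebra_simps)
  then show "sin_cos_integral a (b + 2) = (real b + 1) / (real a + real b + 2) * sin_cos_integral a b"
    using pos by (simp add: field_simps)
qed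

lemma sin_cos_integral_base:
  "sin_cos_integral 0 0 = pi" "sin_cos_integral 1 0 = 2" "sin_cos_integral a 1 = 0"
proof -
  show "sin_cos_integral 0 0 = pi" by (simp add: sin_cos_integral_def)
  have "(\<integral>x. sin x * indicator {0..pi} x \<partial>lborel) = - cos pi - - cos 0"
    by (intro integral_FTC_Icc_real) (auto intro!: derivative_eq_intros continuous_intros)
  then show "sin_cos_integral 1 0 = 2" by (simp add: sin_cos_integral_def)
  have "(\<integral>x. sin x ^ a * cos x * indicator {0..pi} x \<partial>lborel)
      = sin pi ^ (a + 1) / (real a + 1) - sin 0 ^ (a + 1) / (real a + 1)"
  proof (rule integral_FTC_Icc_real)
    fix x :: real
    have "((\<lambda>x. sin x ^ Suc a / (real a + 1)) has_field_derivative
        (1 + of_nat a) * (cos x * sin x ^ a) / (real a + 1)) (at x)"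
      by (intro DERIV_cdivide DERIV_power_Suc DERIV_sin)
    also have "(1 + of_nat a) * (cos x * sin x ^ a) / (real a + 1) = sin x ^ a * cos x"
    proof -
      have "real a + 1 \<noteq> 0" by linarith
      then show ?thesis by (simp add: add.commute)
    qed
    finally show "DERIV (\<lambda>x. sin x ^ (a + 1) / (real a + 1)) x :> sin x ^ a * cos x" by simp
    show "isCont (\<lambda>x. sin x ^ a * cos x) x" by (intro continuous_intros)
  qed simp
  then show "sin_cos_integral a 1 = 0" by (simp add: sin_cos_integral_def)
qed

lemma Gamma_plus1_pos: "x > 0 \<Longrightarrow> Gamma (x + 1) = x * Gamma x" for x :: real
  using pochhammer_Gamma_pos[of x 1] by simp

text \<open>Both sides satisfy the same recursions in steps of two, first in b and, for b = 0, in a.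
  What remains are the three base values; for odd b the integrand is antisymmetric about pi /
  2.\<close>

lemma sin_cos_integral_eq:
  "sin_cos_integral a b = (if even b then
     Gamma ((real a + 1) / 2) * Gamma ((real b + 1) / 2) / Gamma ((real a + real b) / 2 + 1) else 0)"
proof (induction b rule: induct_nat_012)
  case 0
  have "sin_cos_integral a 0 = Gamma ((real a + 1) / 2) * sqrt pi / Gamma (real a / 2 + 1)"
  proof (induction a rule: induct_nat_012)
    case 0
    show ?case using Gamma_fact[of 0, where 'a = real]
      by (simp add: sin_cos_integral_base(1) Gamma_one_half_real)
  next
    case 1
    have "Gamma (1 / 2 + 1 :: real) = 1 / 2 * sqrt pi"
      by (subst Gamma_plus1) (auto simp: Gamma_one_half_real)
    moreover have "Gamma (3 / 2 :: real) \<noteq> 0"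
      using Gamma_real_pos[of "3 / 2"] by linarith
    ultimately have "sqrt pi / Gamma (3 / 2) = 2" by (simp add: nonzero_divide_eq_eq)
    with sin_cos_integral_base(2) show ?case by simp
  next
    case (ge2 a)
    have G: "Gamma ((real a + 1) / 2 + 1) = (real a + 1) / 2 * Gamma ((real a + 1) / 2)"
      by (rule Gamma_plus1_pos) (auto intro: add_nonneg_pos)
    have G': "Gamma (real a / 2 + 1 + 1) = (real a / 2 + 1) * Gamma (real a / 2 + 1)"
      by (rule Gamma_plus1_pos) (auto intro: add_nonneg_pos)
    have e: "real (Suc (Suc a)) / 2 + 1 = real a / 2 + 1 + 1"
      "(real (Suc (Suc a)) + 1) / 2 = (real a + 1) / 2 + 1" by (simp_all add: field_simps)
    have "2 * ((real a / 2 + 1) * x) = (real a + 2) * x" for x by (simp add: algebra_simps)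
    then show ?case
      unfolding e G G' using sin_cos_integral_rec(1)[of a 0] ge2.IH(1) by (simp add: mult.assoc)
  qed
  then show ?case by (simp add: Gamma_one_half_real)
next
  case 1
  show ?case using sin_cos_integral_base(3) by simp
next
  case (ge2 b)
  have G: "Gamma ((real b + 1) / 2 + 1) = (real b + 1) / 2 * Gamma ((real b + 1) / 2)"
    by (rule Gamma_plus1_pos) (auto intro: add_nonneg_pos)
  have G': "Gamma ((real a + real b) / 2 + 1 + 1) = ((real a + real b) / 2 + 1) * Gamma ((real a + real b) / 2 + 1)"
    by (rule Gamma_plus1_pos, rule add_nonneg_pos) auto
  have e: "(real (Suc (Suc b)) + 1) / 2 = (real b + 1) / 2 + 1"
    "(real a + real (Suc (Suc b))) / 2 + 1 = (real a + real b) / 2 + 1 + 1" by (simp_all add: field_simps)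
  have "2 * (((real a + real b) / 2 + 1) * x) = (real a + real b + 2) * x" for x
    by (simp add: algebra_simps)
  then show ?case
    unfolding e G G' using sin_cos_integral_rec(2)[of a b] ge2.IH(1)
    by (simp add: mult_ac)
qed

text \<open>The \<open>p\<close>-th moment of \<open>\<langle>\<alpha>, \<cdot>\<rangle>\<close> under surface measure on the unit sphere in dimension \<open>d\<close>,
  as a function of \<open>x = \<parallel>\<alpha>\<parallel>\<^sup>2\<close>.\<close>

definition sphere_moment :: "nat \<Rightarrow> real \<Rightarrow> nat \<Rightarrow> real" where
  "sphere_moment d x p = (if even p then
     2 * pi powr ((real d - 1) / 2) * Gamma ((real p + 1) / 2) / Gamma ((real p + real d) / 2) * x ^ (p div 2)
     else 0)"

lemma Gamma_plus_half: "Gamma (real k + 1 / 2) = fact (2 * k) * sqrt pi / (4 ^ k * fact k)"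
  using pochhammer_Gamma_pos[of "1 / 2" k] fact_double[of k, where 'a = real]
  by (simp add: Gamma_one_half_real add.commute power_mult)

text \<open>This raises the dimension by one: a linear form becomes \<alpha> cos \<theta> + sin
  \<theta> times a form in d coordinates with squared norm x, and \<theta> has weight sin^(d - 1).
  The left side is the binomial expansion of its p-th power, with sin^q absorbed into the weight.
  After the Gamma factors cancel, the even terms are the binomial expansion of a power of
  \<open>\<alpha>\<^sup>2 + x\<close>.\<close>

lemma sphere_moment_step:
  assumes "d \<ge> 1"
  shows "(\<Sum>q\<le>p. real (p choose q) * \<alpha> ^ (p - q) * sin_cos_integral (d - 1 + q) (p - q) * sphere_moment d x q)
    = sphere_moment (d + 1) (\<alpha>\<^sup>2 + x) p"
proof (cases "even p")
  case False
  then have *: "sin_cos_integral (d - 1 + q) (p - q) * sphere_moment d x q = 0" if "q \<le> p" for q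
    using that by (cases "even q") (auto simp: sin_cos_integral_eq sphere_moment_def)
  have "(\<Sum>q\<le>p. real (p choose q) * \<alpha> ^ (p - q) * sin_cos_integral (d - 1 + q) (p - q) * sphere_moment d x q) = 0"
    using * by (intro sum.neutral) (simp only: mult.assoc atMost_iff, simp)
  with False show ?thesis by (simp add: sphere_moment_def)
next
  case True
  then obtain k where p: "p = 2 * k" by blast
  let ?f = "\<lambda>q. real (p choose q) * \<alpha> ^ (p - q) * sin_cos_integral (d - 1 + q) (p - q) * sphere_moment d x q"
  let ?C = "2 * pi powr (real d / 2) * Gamma (real k + 1 / 2) / Gamma (real k + (real d + 1) / 2)"
  have summand: "?f (2 * j) = ?C * (real (k choose j) * (x ^ j * (\<alpha>\<^sup>2) ^ (k - j)))" if "j \<le> k" for j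
  proof -
    have I: "sin_cos_integral (d - 1 + 2 * j) (p - 2 * j)
      = Gamma (real j + real d / 2) * Gamma (real (k - j) + 1 / 2) / Gamma (real k + (real d + 1) / 2)"
    proof -
      have "(real (d - 1 + 2 * j) + 1) / 2 = real j + real d / 2"
        "(real (p - 2 * j) + 1) / 2 = real (k - j) + 1 / 2"
        "(real (d - 1 + 2 * j) + real (p - 2 * j)) / 2 + 1 = real k + (real d + 1) / 2"
        using that assms by (auto simp: p field_simps of_nat_diff)
      then show ?thesis using p by (simp only: sin_cos_integral_eq) simp
    qed
    have S: "sphere_moment d x (2 * j) = 2 * pi powr (real d / 2 - 1 / 2) * Gamma (real j + 1 / 2) / Gamma (real j + real d / 2) * x ^ j"
      by (simp add: sphere_moment_def add_divide_distrib diff_divide_distrib)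
    have pos: "Gamma (real j + real d / 2) > 0" using assms by (intro Gamma_real_pos) auto
    \<comment> \<open>Writing the Gamma values at half-integers with factorials turns binom(2 k, 2
      j) into binom(k, j).\<close>
    have b: "real (p choose (2 * j)) * Gamma (real (k - j) + 1 / 2) * Gamma (real j + 1 / 2)
        = real (k choose j) * Gamma (real k + 1 / 2) * sqrt pi"
    proof -
      have "p - 2 * j = 2 * (k - j)" using p by simp
      moreover have "(4 :: real) ^ k = 4 ^ j * 4 ^ (k - j)"
        using that by (simp add: power_add[symmetric])
      ultimately show ?thesis
        using that unfolding Gamma_plus_half p
        by (simp add: binomial_fact divide_simps mult_ac)
    qed
    have pp: "pi powr (real d / 2) = pi powr (real d / 2 - 1 / 2) * sqrt pi"
      by (simp add: powr_diff powr_half_sqrt)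
    have \<alpha>: "\<alpha> ^ (p - 2 * j) = (\<alpha>\<^sup>2) ^ (k - j)"
      using p by (simp add: power_mult[symmetric] diff_mult_distrib2)
    have "?f (2 * j) = 2 * pi powr (real d / 2 - 1 / 2) / Gamma (real k + (real d + 1) / 2) * (x ^ j * (\<alpha>\<^sup>2) ^ (k - j))
        * (real (p choose (2 * j)) * Gamma (real (k - j) + 1 / 2) * Gamma (real j + 1 / 2))"
      unfolding I S \<alpha> using pos by simp
    also have "\<dots> = ?C * (real (k choose j) * (x ^ j * (\<alpha>\<^sup>2) ^ (k - j)))"
      unfolding b pp by simp
    finally show ?thesis .
  qed
  have "sum ?f {..p} = sum ?f ((\<lambda>j. 2 * j) ` {..k})"
  proof (rule sum.mono_neutral_right)
    show "\<forall>q\<in>{..p} - (\<lambda>j. 2 * j) ` {..k}. ?f q = 0"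
    proof
      fix q assume q: "q \<in> {..p} - (\<lambda>j. 2 * j) ` {..k}"
      have "odd q"
      proof
        assume "even q"
        then obtain j where "q = 2 * j" by blast
        with q p show False by auto
      qed
      then show "?f q = 0" by (simp add: sphere_moment_def)
    qed
  qed (auto simp: p)
  also have "\<dots> = (\<Sum>j\<le>k. ?f (2 * j))"
    by (subst sum.reindex) (auto simp: inj_on_def)
  also have "\<dots> = ?C * (\<Sum>j\<le>k. real (k choose j) * (x ^ j * (\<alpha>\<^sup>2) ^ (k - j)))"
    unfolding sum_distrib_left by (intro sum.cong refl summand) simp
  also have "(\<Sum>j\<le>k. real (k choose j) * (x ^ j * (\<alpha>\<^sup>2) ^ (k - j))) = (\<alpha>\<^sup>2 + x) ^ k"
    by (subst add.commute) (simp add: binomial_ring mult_ac)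
  finally show ?thesis
    by (simp add: sphere_moment_def p add_divide_distrib add_ac)
qed

text \<open>Here m stands for d - 1, so this is the factor of the hyperspherical density in the
  angle of index i. At i = m the exponent is 0 and the range is the full circle of \<phi>.\<close>

definition sphere_weight :: "nat \<Rightarrow> nat \<Rightarrow> real \<Rightarrow> real" where
  "sphere_weight m i x = sin x ^ (m - i) * indicator {0..(if i < m then pi else 2 * pi)} x"

text \<open>The linear form \<open>\<langle>\<alpha>, \<cdot>\<rangle>\<close> in the hyperspherical coordinates of index \<open>l, \<dots>, m\<close> only,
  divided by \<open>sin (\<theta> 1) \<dots> sin (\<theta> l)\<close>; the induction over the dimension decreases \<open>l\<close>.\<close>

definition sphere_linear :: "(nat \<Rightarrow> real) \<Rightarrow> nat \<Rightarrow> nat \<Rightarrow> (nat \<Rightarrow> real) \<Rightarrow> real" where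
  "sphere_linear \<alpha> l m \<theta> =
     (\<Sum>i=l..m. \<alpha> i * ((\<Prod>j=Suc l..i. sin (\<theta> j)) * (if i < m then cos (\<theta> (i + 1)) else 1)))"

lemma sphere_linear_rec:
  assumes "l < m"
  shows "sphere_linear \<alpha> l m \<theta>
    = \<alpha> l * cos (\<theta> (Suc l)) + sin (\<theta> (Suc l)) * sphere_linear \<alpha> (Suc l) m \<theta>"
proof -
  have "(\<Prod>j=Suc l..i. sin (\<theta> j)) = sin (\<theta> (Suc l)) * (\<Prod>j=Suc (Suc l)..i. sin (\<theta> j))"
    if "i \<in> {Suc l..m}" for i
    using that by (simp add: prod.atLeast_Suc_atMost)
  then have "(\<Sum>i=Suc l..m. \<alpha> i * ((\<Prod>j=Suc l..i. sin (\<theta> j)) * (if i < m then cos (\<theta> (i + 1)) else 1)))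
      = sin (\<theta> (Suc l)) * sphere_linear \<alpha> (Suc l) m \<theta>"
    unfolding sphere_linear_def sum_distrib_left by (intro sum.cong refl) simp
  then show ?thesis
    using assms by (simp add: sphere_linear_def sum.atLeast_Suc_atMost)
qed

lemma sphere_linear_cong:
  "(\<And>j. j \<in> {Suc l..m} \<Longrightarrow> \<theta> j = \<theta>' j) \<Longrightarrow> sphere_linear \<alpha> l m \<theta> = sphere_linear \<alpha> l m \<theta>'"
  unfolding sphere_linear_def
  by (intro sum.cong refl arg_cong2[where f = "(*)"] prod.cong) auto

lemma abs_sphere_linear_le: "\<bar>sphere_linear \<alpha> l m \<theta>\<bar> \<le> (\<Sum>i=l..m. \<bar>\<alpha> i\<bar>)"
proof -
  have "\<bar>sphere_linear \<alpha> l m \<theta>\<bar>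
      \<le> (\<Sum>i=l..m. \<bar>\<alpha> i * ((\<Prod>j=Suc l..i. sin (\<theta> j)) * (if i < m then cos (\<theta> (i + 1)) else 1))\<bar>)"
    unfolding sphere_linear_def by (rule sum_abs)
  also have "\<dots> \<le> (\<Sum>i=l..m. \<bar>\<alpha> i\<bar>)"
  proof (intro sum_mono)
    fix i
    have "\<bar>\<Prod>j=Suc l..i. sin (\<theta> j)\<bar> \<le> 1"
      unfolding abs_prod by (intro prod_le_1) auto
    then have "\<bar>(\<Prod>j=Suc l..i. sin (\<theta> j)) * (if i < m then cos (\<theta> (i + 1)) else 1)\<bar> \<le> 1"
      by (auto simp: abs_mult intro: mult_le_one)
    then show "\<bar>\<alpha> i * ((\<Prod>j=Suc l..i. sin (\<theta> j)) * (if i < m then cos (\<theta> (i + 1)) else 1))\<bar> \<le> \<bar>\<alpha> i\<bar>"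
      unfolding abs_mult[of "\<alpha> i"] by (rule mult_left_le) simp
  qed
  finally show ?thesis .
qed

lemma measurable_sphere_linear [measurable]:
  "sphere_linear \<alpha> l m \<in> borel_measurable (PiM {Suc l..m} (\<lambda>_. lborel))"
proof -
  have trig: "(\<lambda>\<theta>. sin (\<theta> j) :: real) \<in> borel_measurable (PiM {Suc l..m} (\<lambda>_. lborel))"
    "(\<lambda>\<theta>. cos (\<theta> j) :: real) \<in> borel_measurable (PiM {Suc l..m} (\<lambda>_. lborel))"
    if "j \<in> {Suc l..m}" for j
    using measurable_compose[OF measurable_component_singleton[OF that, where M = "\<lambda>_. lborel"], of "sin :: real \<Rightarrow> real" borel]
      measurable_compose[OF measurable_component_singleton[OF that, where M = "\<lambda>_. lborel"], of "cos :: real \<Rightarrow> real" borel]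
    by (auto intro!: borel_measurable_continuous_onI continuous_intros)
  show ?thesis
    unfolding sphere_linear_def[abs_def]
  proof (intro borel_measurable_sum borel_measurable_times borel_measurable_const borel_measurable_prod)
    fix i assume "i \<in> {l..m}"
    show "(\<lambda>\<theta>. if i < m then cos (\<theta> (i + 1)) else 1 :: real) \<in> borel_measurable (PiM {Suc l..m} (\<lambda>_. lborel))"
    \<comment> \<open>Only for i < m is i + 1 an index of the product space.\<close>
    proof (cases "i < m")
      case True
      with \<open>i \<in> {l..m}\<close> have "i + 1 \<in> {Suc l..m}" by simp
      with True show ?thesis by (simp only: if_True) (rule trig(2))
    qed simp
  qed (use trig(1) in auto)
qed

lemma measurable_sphere_weight [measurable]: "sphere_weight m i \<in> borel_measurable borel"
  unfolding sphere_weight_def[abs_def] by measurable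

lemma integrable_sphere_weight: "integrable lborel (sphere_weight m i)"
  unfolding sphere_weight_def[abs_def]
  by (intro integrable_indicator_mult_continuous continuous_intros)

lemma integrable_sphere_moment:
  "integrable (PiM {Suc l..m} (\<lambda>_. lborel))
     (\<lambda>\<theta>. (\<Prod>i=Suc l..m. sphere_weight m i (\<theta> i)) * sphere_linear \<alpha> l m \<theta> ^ p)"
proof (rule Bochner_Integration.integrable_bound)
  let ?R = "\<Sum>i=l..m. \<bar>\<alpha> i\<bar>"
  show "integrable (PiM {Suc l..m} (\<lambda>_. lborel)) (\<lambda>\<theta>. (\<Prod>i=Suc l..m. sphere_weight m i (\<theta> i)) * ?R ^ p)"
    by (intro integrable_mult_left lborel_product.product_integrable_prod integrable_sphere_weight) auto
  show "AE \<theta> in PiM {Suc l..m} (\<lambda>_. lborel).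
      norm ((\<Prod>i=Suc l..m. sphere_weight m i (\<theta> i)) * sphere_linear \<alpha> l m \<theta> ^ p)
      \<le> norm ((\<Prod>i=Suc l..m. sphere_weight m i (\<theta> i)) * ?R ^ p)"
  proof (rule AE_I2)
    fix \<theta> :: "nat \<Rightarrow> real"
    have "?R \<ge> 0" by (intro sum_nonneg) auto
    then show "norm ((\<Prod>i=Suc l..m. sphere_weight m i (\<theta> i)) * sphere_linear \<alpha> l m \<theta> ^ p)
      \<le> norm ((\<Prod>i=Suc l..m. sphere_weight m i (\<theta> i)) * ?R ^ p)"
      unfolding norm_mult norm_power using abs_sphere_linear_le[of \<alpha> l m \<theta>]
      by (intro mult_left_mono power_mono) auto
  qed
  have [measurable]: "(\<lambda>\<theta>. \<Prod>i=Suc l..m. sphere_weight m i (\<theta> i)) \<in> borel_measurable (PiM {Suc l..m} (\<lambda>_. lborel))"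
    by (intro borel_measurable_prod measurable_compose[OF _ measurable_sphere_weight]) measurable
  show "(\<lambda>\<theta>. (\<Prod>i=Suc l..m. sphere_weight m i (\<theta> i)) * sphere_linear \<alpha> l m \<theta> ^ p)
      \<in> borel_measurable (PiM {Suc l..m} (\<lambda>_. lborel))"
    by measurable
qed

lemma integral_sin_pow_mult_linear_pow:
  "integrable lborel (\<lambda>x. sin x ^ k * indicator {0..pi} x * (a * cos x + sin x * b) ^ p)" (is ?int)
  "(\<integral>x. sin x ^ k * indicator {0..pi} x * (a * cos x + sin x * b) ^ p \<partial>lborel)
    = (\<Sum>q\<le>p. real (p choose q) * a ^ (p - q) * sin_cos_integral (k + q) (p - q) * b ^ q)" (is ?eq)
proof -
  have "integrable lborel (\<lambda>x. (sin x ^ k * (a * cos x + sin x * b) ^ p) * indicator {0..pi} x)"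
    by (intro integrable_indicator_mult_continuous continuous_intros)
  then show ?int by (simp only: mult_ac)
  have int: "integrable lborel (\<lambda>x :: real. sin x ^ k * cos x ^ l * indicator {0..pi} x)" for k l
    by (intro integrable_indicator_mult_continuous continuous_intros)
  have "sin x ^ k * indicator {0..pi} x * (a * cos x + sin x * b) ^ p
      = (\<Sum>q\<le>p. real (p choose q) * a ^ (p - q) * b ^ q * (sin x ^ (k + q) * cos x ^ (p - q) * indicator {0..pi} x))" for x
  proof -
    have "(a * cos x + sin x * b) ^ p = (\<Sum>q\<le>p. real (p choose q) * (sin x * b) ^ q * (a * cos x) ^ (p - q))"
      by (subst add.commute) (rule binomial_ring)
    then show ?thesis
      by (simp add: sum_distrib_left power_mult_distrib power_add mult_ac)
  qed
  then have "(\<integral>x. sin x ^ k * indicator {0..pi} x * (a * cos x + sin x * b) ^ p \<partial>lborel)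
      = (\<Sum>q\<le>p. real (p choose q) * a ^ (p - q) * b ^ q * sin_cos_integral (k + q) (p - q))"
    by (simp only: sin_cos_integral_def)
      (subst Bochner_Integration.integral_sum, auto intro!: integrable_mult_right int)
  then show ?eq by (simp only: mult_ac)
qed

text \<open>The unit sphere of the line is {-1, 1} with counting measure, so the moment is b^p +
  (-b)^p.\<close>

lemma sphere_moment_1: "sphere_moment 1 (b\<^sup>2) p = (1 + (-1) ^ p) * b ^ p"
proof (cases "even p")
  case True
  have "Gamma ((real p + 1) / 2) \<noteq> 0" 
    by (rule less_imp_neq[THEN not_sym, OF Gamma_real_pos]) simp
  moreover have "(b\<^sup>2) ^ (p div 2) = b ^ p" using True by (simp flip: power_mult)
  ultimately show ?thesis using True by (simp add: sphere_moment_def)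
qed (simp add: sphere_moment_def)

text \<open>The last angle runs over the full circle, unlike the angles treated by
  \<open>sphere_moment_step\<close>. A shift by pi changes the sign of the form, so the lower half
  contributes (-1)^p times the upper half. The resulting factor 1 + (-1)^p is a moment of the
  0-sphere, and the dimension step from 1 to 2 applies.\<close>

lemma sphere_moment_2:
  "(\<integral>x. indicator {0..2 * pi} x * (a * cos x + sin x * b) ^ p \<partial>lborel) = sphere_moment 2 (a\<^sup>2 + b\<^sup>2) p"
proof -
  let ?f = "\<lambda>x. (a * cos x + sin x * b) ^ p"
  have int: "integrable lborel (\<lambda>x. ?f x * indicator {u..v} x)" for u v
    by (intro integrable_indicator_mult_continuous continuous_intros)
  have "(\<integral>x. ?f x * indicator {pi..2 * pi} x \<partial>lborel)
      = (\<integral>x. ?f (pi + 1 * x) * indicator {pi..2 * pi} (pi + 1 * x) \<partial>lborel)"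
    using lborel_integral_real_affine[of 1 "\<lambda>x. ?f x * indicator {pi..2 * pi} x" pi] by simp
  also have "\<dots> = (\<integral>x. (-1) ^ p * (?f x * indicator {0..pi} x) \<partial>lborel)"
  proof (intro Bochner_Integration.integral_cong refl)
    fix x :: real
    have "a * cos (pi + 1 * x) + sin (pi + 1 * x) * b = (-1) * (a * cos x + sin x * b)"
      by (simp add: cos_add sin_add)
    then show "?f (pi + 1 * x) * indicator {pi..2 * pi} (pi + 1 * x) = (-1) ^ p * (?f x * indicator {0..pi} x)"
      by (simp only: power_mult_distrib mult.assoc) (simp add: indicator_def)
  qed
  also have "\<dots> = (-1) ^ p * (\<integral>x. ?f x * indicator {0..pi} x \<partial>lborel)" by simp
  finally have shift: "(\<integral>x. ?f x * indicator {pi..2 * pi} x \<partial>lborel)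
      = (-1) ^ p * (\<integral>x. ?f x * indicator {0..pi} x \<partial>lborel)" .
  have "(\<integral>x. indicator {0..2 * pi} x * ?f x \<partial>lborel)
      = (\<integral>x. ?f x * indicator {0..pi} x + ?f x * indicator {pi..2 * pi} x \<partial>lborel)"
  proof (rule integral_cong_AE)
    have "AE x in lborel. x \<noteq> pi" by (rule AE_lborel_singleton)
    then show "AE x in lborel. indicator {0..2 * pi} x * ?f x = ?f x * indicator {0..pi} x + ?f x * indicator {pi..2 * pi} x"
      by eventually_elim (auto simp: indicator_def)
  qed measurable
  also have "\<dots> = (1 + (-1) ^ p) * (\<integral>x. ?f x * indicator {0..pi} x \<partial>lborel)"
    by (subst Bochner_Integration.integral_add[OF int int]) (simp add: shift distrib_right)
  also have "(\<integral>x. ?f x * indicator {0..pi} x \<partial>lborel)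
      = (\<Sum>q\<le>p. real (p choose q) * a ^ (p - q) * sin_cos_integral (1 - 1 + q) (p - q) * b ^ q)"
    using integral_sin_pow_mult_linear_pow(2)[of 0 a b p] by (simp add: mult.commute)
  also have "(1 + (-1) ^ p) * \<dots> = (\<Sum>q\<le>p. real (p choose q) * a ^ (p - q) * sin_cos_integral (1 - 1 + q) (p - q) * sphere_moment 1 (b\<^sup>2) q)"
    unfolding sum_distrib_left
  proof (intro sum.cong refl)
    \<comment> \<open>The factor should be 1 + (-1)^q instead of 1 + (-1)^p. They agree if p - q is
      even, and otherwise the trigonometric integral is 0.\<close>
    fix q assume "q \<in> {..p}"
    then have "sin_cos_integral (1 - 1 + q) (p - q) = 0 \<or> (-1 :: real) ^ p = (-1) ^ q"
      by (cases "even (p - q)") (auto simp: sin_cos_integral_eq minus_one_power_iff)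
    then show "(1 + (-1) ^ p) * (real (p choose q) * a ^ (p - q) * sin_cos_integral (1 - 1 + q) (p - q) * b ^ q)
        = real (p choose q) * a ^ (p - q) * sin_cos_integral (1 - 1 + q) (p - q) * sphere_moment 1 (b\<^sup>2) q"
      unfolding sphere_moment_1 by auto
  qed
  also have "\<dots> = sphere_moment (1 + 1) (a\<^sup>2 + b\<^sup>2) p"
    by (rule sphere_moment_step) simp
  finally show ?thesis by (simp only: one_add_one)
qed

text \<open>The induction starts at l = m - 1, where only the full-circle angle is left. Each step
  integrates out the angle of index l + 1, whose weight is sin^(m - l - 1) on [0, pi].\<close>

theorem integral_sphere_linear_power:
  assumes "l < m"
  shows "(\<integral>\<theta>. (\<Prod>i=Suc l..m. sphere_weight m i (\<theta> i)) * sphere_linear \<alpha> l m \<theta> ^ p \<partial>PiM {Suc l..m} (\<lambda>_. lborel))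
    = sphere_moment (m + 1 - l) (\<Sum>i=l..m. (\<alpha> i)\<^sup>2) p"
proof -
  have "l \<le> m - 1" using assms by simp
  then show ?thesis
  proof (induction l arbitrary: p rule: inc_induct)
    case base
    obtain m' where m: "m = Suc m'" using assms by (cases m) auto
    have "(\<integral>\<theta>. (\<Prod>i\<in>{m}. sphere_weight m i (\<theta> i)) * sphere_linear \<alpha> m' m \<theta> ^ p \<partial>PiM {m} (\<lambda>_. lborel))
      = (\<integral>\<theta>. (\<lambda>x. indicator {0..2 * pi} x * (\<alpha> m' * cos x + sin x * \<alpha> m) ^ p) (\<theta> m) \<partial>PiM {m} (\<lambda>_. lborel))"
      by (intro Bochner_Integration.integral_cong refl)
        (simp add: m sphere_linear_rec sphere_weight_def, simp add: sphere_linear_def)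
    also have "\<dots> = (\<integral>x. indicator {0..2 * pi} x * (\<alpha> m' * cos x + sin x * \<alpha> m) ^ p \<partial>lborel)"
      by (rule lborel_product.product_integral_singleton) measurable
    also have "\<dots> = sphere_moment 2 ((\<alpha> m')\<^sup>2 + (\<alpha> m)\<^sup>2) p"
      by (rule sphere_moment_2)
    finally show ?case by (simp add: m)
  next
    case (step l)
    let ?P = "\<lambda>l. PiM {Suc l..m} (\<lambda>_. lborel :: real measure)"
    let ?W = "\<lambda>l \<theta>. \<Prod>i=Suc l..m. sphere_weight m i (\<theta> i)"
    let ?X = "\<Sum>i=Suc l..m. (\<alpha> i)\<^sup>2"
    have l: "l < m" "Suc l < m" using step.hyps by auto
    have ins: "{Suc l..m} = insert (Suc l) {Suc (Suc l)..m}" using l by auto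
    have "(\<integral>\<theta>. ?W l \<theta> * sphere_linear \<alpha> l m \<theta> ^ p \<partial>?P l)
        = (\<integral>\<theta>. \<integral>x. ?W l (\<theta>(Suc l := x)) * sphere_linear \<alpha> l m (\<theta>(Suc l := x)) ^ p \<partial>lborel \<partial>?P (Suc l))"
      using lborel_product.product_integral_insert[of "{Suc (Suc l)..m}" "Suc l"
          "\<lambda>\<theta>. ?W l \<theta> * sphere_linear \<alpha> l m \<theta> ^ p", folded ins] integrable_sphere_moment[of l m \<alpha> p]
      by simp
    also have "\<dots> = (\<integral>\<theta>. (\<Sum>q\<le>p. real (p choose q) * \<alpha> l ^ (p - q) * sin_cos_integral (m - l - 1 + q) (p - q)
          * (?W (Suc l) \<theta> * sphere_linear \<alpha> (Suc l) m \<theta> ^ q)) \<partial>?P (Suc l))"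
    proof (intro Bochner_Integration.integral_cong refl)
      fix \<theta> :: "nat \<Rightarrow> real"
      let ?S = "sphere_linear \<alpha> (Suc l) m \<theta>"
      have "?W l (\<theta>(Suc l := x)) * sphere_linear \<alpha> l m (\<theta>(Suc l := x)) ^ p
          = ?W (Suc l) \<theta> * (sin x ^ (m - l - 1) * indicator {0..pi} x * (\<alpha> l * cos x + sin x * ?S) ^ p)" for x
      proof -
        have "?W l (\<theta>(Suc l := x)) = sphere_weight m (Suc l) x * ?W (Suc l) \<theta>"
          unfolding ins by (subst prod.insert) (auto intro!: prod.cong)
        moreover have "sphere_linear \<alpha> (Suc l) m (\<theta>(Suc l := x)) = ?S"
          by (rule sphere_linear_cong) auto
        moreover have "sphere_weight m (Suc l) x = sin x ^ (m - l - 1) * indicator {0..pi} x"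
          using l by (simp add: sphere_weight_def)
        ultimately show ?thesis
          unfolding sphere_linear_rec[OF l(1)] by (simp only: fun_upd_same mult_ac)
      qed
      then have "(\<integral>x. ?W l (\<theta>(Suc l := x)) * sphere_linear \<alpha> l m (\<theta>(Suc l := x)) ^ p \<partial>lborel)
          = ?W (Suc l) \<theta> * (\<Sum>q\<le>p. real (p choose q) * \<alpha> l ^ (p - q) * sin_cos_integral (m - l - 1 + q) (p - q) * ?S ^ q)"
        by (simp only: integral_mult_right_zero integral_sin_pow_mult_linear_pow(2))
      then show "(\<integral>x. ?W l (\<theta>(Suc l := x)) * sphere_linear \<alpha> l m (\<theta>(Suc l := x)) ^ p \<partial>lborel)
          = (\<Sum>q\<le>p. real (p choose q) * \<alpha> l ^ (p - q) * sin_cos_integral (m - l - 1 + q) (p - q)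
          * (?W (Suc l) \<theta> * ?S ^ q))"
        by (simp only: sum_distrib_left mult_ac)
    qed
    also have "\<dots> = (\<Sum>q\<le>p. real (p choose q) * \<alpha> l ^ (p - q) * sin_cos_integral (m - l - 1 + q) (p - q)
          * sphere_moment (m + 1 - Suc l) ?X q)"
      by (subst Bochner_Integration.integral_sum)
        (auto simp only: integral_mult_right_zero step.IH intro!: integrable_mult_right integrable_sphere_moment)
    \<comment> \<open>The dimension step is taken from m - l, the number of coordinates with index l
      + 1, ..., m.\<close>
    also have "\<dots> = sphere_moment (m - l + 1) ((\<alpha> l)\<^sup>2 + ?X) p"
      using sphere_moment_step[of "m - l" p "\<alpha> l" ?X] l by simp
    also have "(\<alpha> l)\<^sup>2 + ?X = (\<Sum>i=l..m. (\<alpha> i)\<^sup>2)"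
      using l by (simp add: sum.atLeast_Suc_atMost)
    finally show ?case using l by (simp add: Suc_diff_le)
  qed
qed

section \<open>From angles to the uniform distribution on the sphere\<close>

lemma sphere_linear_eq_inner_hyperspherical_point:
  fixes \<alpha> :: "real ^ 'd"
  obtains \<beta> where "\<And>\<theta>. \<alpha> \<bullet> hyperspherical_point \<theta> = sphere_linear \<beta> 0 (CARD('d) - 1) \<theta>"
    and "(\<Sum>i=0..CARD('d) - 1. (\<beta> i)\<^sup>2) = (norm \<alpha>)\<^sup>2"
proof
  let ?n = "to_nat_on (UNIV :: 'd set)"
  define \<beta> where "\<beta> i = \<alpha> $ inv_into UNIV ?n i" for i
  have bij: "bij_betw ?n UNIV {..<CARD('d)}" by (rule to_nat_on_finite) simp
  have \<beta>: "\<beta> (?n k) = \<alpha> $ k" for k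
    using bij by (simp add: \<beta>_def bij_betw_def)
  have set: "{..<CARD('d)} = {0..CARD('d) - 1}"
    using zero_less_card_finite[where 'a = 'd]
    by (cases "CARD('d)") (simp_all add: lessThan_Suc_atMost atMost_atLeast0)
  show "\<alpha> \<bullet> hyperspherical_point \<theta> = sphere_linear \<beta> 0 (CARD('d) - 1) \<theta>" for \<theta>
    unfolding sphere_linear_def set[symmetric]
    by (subst sum.reindex_bij_betw[OF bij, symmetric])
      (simp add: inner_vec_def hyperspherical_point_def \<beta> Let_def)
  show "(\<Sum>i=0..CARD('d) - 1. (\<beta> i)\<^sup>2) = (norm \<alpha>)\<^sup>2"
    unfolding set[symmetric]
    by (subst sum.reindex_bij_betw[OF bij, symmetric])
      (simp only: power2_norm_eq_inner, simp add: inner_vec_def \<beta> power2_eq_square)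
qed

lemma measurable_hyperspherical_point:
  "(hyperspherical_point :: _ \<Rightarrow> real ^ 'd) \<in> borel_measurable (PiM {1..CARD('d) - 1} (\<lambda>_. lborel))"
proof (subst borel_measurable_euclidean_space, intro ballI)
  fix \<alpha> :: "real ^ 'd"
  obtain \<beta> where "\<And>\<theta>. \<alpha> \<bullet> hyperspherical_point \<theta> = sphere_linear \<beta> 0 (CARD('d) - 1) \<theta>"
    using sphere_linear_eq_inner_hyperspherical_point by blast
  then show "(\<lambda>\<theta>. hyperspherical_point \<theta> \<bullet> \<alpha>) \<in> borel_measurable (PiM {1..CARD('d) - 1} (\<lambda>_. lborel))"
    using measurable_sphere_linear[of \<beta> 0 "CARD('d) - 1"] by (simp add: inner_commute)
qed

text \<open>The indicator of the angle domain is distributed over the coordinates; the resulting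
  product of one-variable weights allows integration one angle at a time.\<close>

lemma hyperspherical_density_eq:
  assumes "d \<ge> 2"
  shows "hyperspherical_density d \<theta> = Gamma (real d / 2) / (2 * pi powr (real d / 2))
    * (\<Prod>i=Suc 0..d - 1. sphere_weight (d - 1) i (\<theta> i))"
proof -
  obtain m where d: "d = Suc (Suc m)" using assms by (metis add_2_eq_Suc le_Suc_ex)
  have last: "(\<Prod>i=Suc 0..Suc m. sphere_weight (Suc m) i (\<theta> i))
      = (\<Prod>i=Suc 0..m. sin (\<theta> i) ^ (Suc m - i) * indicator {0..pi} (\<theta> i)) * indicator {0..2 * pi} (\<theta> (Suc m))"
    by (simp add: sphere_weight_def)
  have "(\<Prod>i=1..m. sin (\<theta> i) ^ (Suc m - i)) * indicator (hyperspherical_angles d) \<theta>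
      = (\<Prod>i=Suc 0..Suc m. sphere_weight (Suc m) i (\<theta> i))"
  proof (cases "\<theta> \<in> hyperspherical_angles d")
    case True
    then show ?thesis
      unfolding last by (auto simp: hyperspherical_angles_def d intro!: prod.cong)
  next
    case False
    then have "(\<exists>i\<in>{Suc 0..m}. sin (\<theta> i) ^ (Suc m - i) * indicator {0..pi} (\<theta> i) = 0)
        \<or> indicator {0..2 * pi} (\<theta> (Suc m)) = (0 :: real)"
      by (auto simp: hyperspherical_angles_def d indicator_def)
    then have "(\<Prod>i=Suc 0..Suc m. sphere_weight (Suc m) i (\<theta> i)) = 0"
      unfolding last
      using prod_zero[of "{Suc 0..m}" "\<lambda>i. sin (\<theta> i) ^ (Suc m - i) * indicator {0..pi} (\<theta> i)"]
      by (simp only: mult_eq_0_iff finite_atLeastAtMost) blast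
    with False show ?thesis by simp
  qed
  then show ?thesis by (simp add: hyperspherical_density_def d mult.assoc)
qed

lemma sphere_weight_nonneg: "i \<le> m \<Longrightarrow> sphere_weight m i x \<ge> 0"
  by (cases "i < m") (auto simp: sphere_weight_def indicator_def intro!: zero_le_power sin_ge_zero)

lemma uniform_sphere_moment:
  fixes \<alpha> :: "real ^ 'd"
  assumes d: "CARD('d) \<ge> 2"
  shows "(\<integral>v. (\<alpha> \<bullet> v) ^ p \<partial>uniform_sphere)
    = Gamma (real CARD('d) / 2) / (2 * pi powr (real CARD('d) / 2)) * sphere_moment CARD('d) ((norm \<alpha>)\<^sup>2) p"
proof -
  let ?d = "CARD('d)"
  let ?m = "?d - 1"
  let ?C = "Gamma (real ?d / 2) / (2 * pi powr (real ?d / 2))"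
  let ?W = "\<lambda>\<theta>. \<Prod>i=Suc 0..?m. sphere_weight ?m i (\<theta> i)"
  obtain \<beta> where \<beta>: "\<And>\<theta>. \<alpha> \<bullet> hyperspherical_point \<theta> = sphere_linear \<beta> 0 ?m \<theta>"
    "(\<Sum>i=0..?m. (\<beta> i)\<^sup>2) = (norm \<alpha>)\<^sup>2"
    using sphere_linear_eq_inner_hyperspherical_point by blast
  note [measurable] = measurable_hyperspherical_point
  have dens: "hyperspherical_density ?d = (\<lambda>\<theta>. ?C * ?W \<theta>)"
    by (rule ext) (rule hyperspherical_density_eq[OF d])
  have W [measurable]: "?W \<in> borel_measurable (PiM {1..?m} (\<lambda>_. lborel))"
    by (intro borel_measurable_prod measurable_compose[OF _ measurable_sphere_weight]) measurable
  have C: "?C \<ge> 0" by simp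
  have "(\<integral>v. (\<alpha> \<bullet> v) ^ p \<partial>uniform_sphere)
      = (\<integral>\<theta>. sphere_linear \<beta> 0 ?m \<theta> ^ p \<partial>density (PiM {1..?m} (\<lambda>_. lborel)) (\<lambda>\<theta>. ennreal (?C * ?W \<theta>)))"
    unfolding uniform_sphere_def dens by (subst integral_distr) (use measurable_hyperspherical_point in \<open>auto simp: \<beta>(1)\<close>)
  also have "\<dots> = (\<integral>\<theta>. (?C * ?W \<theta>) *\<^sub>R sphere_linear \<beta> 0 ?m \<theta> ^ p \<partial>PiM {1..?m} (\<lambda>_. lborel))"
  proof (rule integral_density)
    show "(\<lambda>\<theta>. sphere_linear \<beta> 0 ?m \<theta> ^ p) \<in> borel_measurable (PiM {1..?m} (\<lambda>_. lborel))"
      using measurable_sphere_linear[of \<beta> 0 ?m] by (intro borel_measurable_power) simp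
    show "(\<lambda>\<theta>. ?C * ?W \<theta>) \<in> borel_measurable (PiM {1..?m} (\<lambda>_. lborel))"
      by (intro borel_measurable_times borel_measurable_const W)
    show "AE \<theta> in PiM {1..?m} (\<lambda>_. lborel). 0 \<le> ?C * ?W \<theta>"
      by (intro AE_I2 mult_nonneg_nonneg C prod_nonneg ballI sphere_weight_nonneg) auto
  qed
  also have "\<dots> = ?C * (\<integral>\<theta>. ?W \<theta> * sphere_linear \<beta> 0 ?m \<theta> ^ p \<partial>PiM {Suc 0..?m} (\<lambda>_. lborel))"
    unfolding real_scaleR_def mult.assoc[of ?C] integral_mult_right_zero One_nat_def ..
  also have "\<dots> = ?C * sphere_moment ?d ((norm \<alpha>)\<^sup>2) p"
    using d integral_sphere_linear_power[of 0 ?m \<beta> p, unfolded \<beta>(2)] by simp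
  finally show ?thesis .
qed

text \<open>Any bound will do. The sum of the absolute coordinates of \<alpha> comes directly from
  the coordinate formula, with no appeal to the points having norm 1.\<close>

lemma AE_uniform_sphere_inner_le:
  fixes \<alpha> :: "real ^ 'd"
  obtains R where "R \<ge> 0" "AE v in uniform_sphere. \<bar>\<alpha> \<bullet> v\<bar> \<le> R"
proof -
  obtain \<beta> where \<beta>: "\<And>\<theta>. \<alpha> \<bullet> hyperspherical_point \<theta> = sphere_linear \<beta> 0 (CARD('d) - 1) \<theta>"
    using sphere_linear_eq_inner_hyperspherical_point by blast
  let ?R = "\<Sum>i=0..CARD('d) - 1. \<bar>\<beta> i\<bar>"
  have "AE v in uniform_sphere. \<bar>\<alpha> \<bullet> v\<bar> \<le> ?R"
    unfolding uniform_sphere_def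
    by (subst AE_distr_iff) (use measurable_hyperspherical_point in \<open>auto simp: \<beta> abs_sphere_linear_le\<close>)
  moreover have "?R \<ge> 0" by (intro sum_nonneg) auto
  ultimately show ?thesis by (rule that[rotated])
qed

text \<open>By the duplication formula the moment of order 2 k, divided by (2 k)!, is the term of
  \<open>bessel_norm\<close> whose denominator is \<open>fact k * pochhammer (d / 2) k\<close>,
  hence the order d / 2 - 1. That the total mass is 1 is assumed here; for a flight it is inherited
  from the law of \<open>V 1\<close>.\<close>

lemma uniform_sphere_mgf:
  fixes \<alpha> :: "real ^ 'd"
  assumes d: "CARD('d) \<ge> 2" and "prob_space (uniform_sphere :: (real ^ 'd) measure)"
  shows "(\<integral>\<^sup>+v. ennreal (exp (\<alpha> \<bullet> v)) \<partial>uniform_sphere)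
    = ennreal (bessel_norm (real CARD('d) / 2 - 1) ((norm \<alpha>)\<^sup>2 / 4))"
proof -
  let ?d = "CARD('d)"
  let ?v = "real ?d / 2 - 1"
  interpret prob_space "uniform_sphere :: (real ^ 'd) measure" by fact
  have sets [measurable_cong]: "sets (uniform_sphere :: (real ^ 'd) measure) = sets borel"
    by (simp add: uniform_sphere_def)
  obtain R where R: "AE v in uniform_sphere. \<bar>\<alpha> \<bullet> v\<bar> \<le> R"
    using AE_uniform_sphere_inner_le by blast
  have meas [measurable]: "(\<lambda>v. \<alpha> \<bullet> v) \<in> borel_measurable uniform_sphere" by measurable
  have coeff: "expectation (\<lambda>v. (\<alpha> \<bullet> v) ^ p) / fact p
      = (if even p then bessel_coeff ?v (p div 2) * ((norm \<alpha>)\<^sup>2 / 4) ^ (p div 2) else 0)" for p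
  proof (cases "even p")
    case True
    then obtain k where p: "p = 2 * k" by blast
    have G: "Gamma (real k + real ?d / 2) = pochhammer (real ?d / 2) k * Gamma (real ?d / 2)"
      using pochhammer_Gamma_pos[of "real ?d / 2" k] d by (simp add: add.commute)
    have pos: "Gamma (real ?d / 2) \<noteq> 0"
      using d by (intro less_imp_neq[THEN not_sym, OF Gamma_real_pos]) simp
    have pp: "pi powr (real ?d / 2) = pi powr ((real ?d - 1) / 2) * sqrt pi"
      by (simp add: powr_diff diff_divide_distrib powr_half_sqrt)
    have "sphere_moment ?d ((norm \<alpha>)\<^sup>2) p
        = 2 * pi powr ((real ?d - 1) / 2) * Gamma (real k + 1 / 2) / Gamma (real k + real ?d / 2) * ((norm \<alpha>)\<^sup>2) ^ k"
      by (simp add: sphere_moment_def p add_divide_distrib)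
    then have "expectation (\<lambda>v. (\<alpha> \<bullet> v) ^ p)
        = fact (2 * k) / (4 ^ k * fact k * pochhammer (real ?d / 2) k) * ((norm \<alpha>)\<^sup>2) ^ k"
      unfolding uniform_sphere_moment[OF d] Gamma_plus_half G pp using pos by simp
    then show ?thesis
      by (simp add: p bessel_coeff_def power_divide del: fact_double)
  qed (simp add: uniform_sphere_moment[OF d] sphere_moment_def)
  have "(\<lambda>k. bessel_coeff ?v k * ((norm \<alpha>)\<^sup>2 / 4) ^ k) sums expectation (\<lambda>v. exp (\<alpha> \<bullet> v))"
    using exp_moments_sums[OF meas R, of "1 :: real"]
      sums_even_reindex[of "\<lambda>k. bessel_coeff ?v k * ((norm \<alpha>)\<^sup>2 / 4) ^ k" 1 "expectation (\<lambda>v. exp (\<alpha> \<bullet> v))"]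
    by (simp add: coeff)
  then have E: "expectation (\<lambda>v. exp (\<alpha> \<bullet> v)) = bessel_norm ?v ((norm \<alpha>)\<^sup>2 / 4)"
    by (simp add: bessel_norm_def sums_iff)
  have "integrable uniform_sphere (\<lambda>v. exp (\<alpha> \<bullet> v))"
    by (rule integrable_const_bound[where B = "exp R"]) (use R in \<open>auto elim!: eventually_mono\<close>)
  then show ?thesis
    by (simp add: nn_integral_eq_integral E)
qed

section \<open>Random flights\<close>

lemma indep_random_elements_distr:
  assumes "prob_space M" "indep_random_elements M N X N' Y"
  shows "distr M (N \<Otimes>\<^sub>M N') (\<lambda>\<omega>. (X \<omega>, Y \<omega>)) = distr M N X \<Otimes>\<^sub>M distr M N' Y"
proof -
  interpret prob_space M by fact
  have [measurable]: "X \<in> measurable M N" "Y \<in> measurable M N'"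
    using assms(2) by (auto simp: indep_random_elements_def)
  have ind: "indep_set {X -` A \<inter> space M | A. A \<in> sets N} {Y -` B \<inter> space M | B. B \<in> sets N'}"
    using assms(2) by (simp add: indep_random_elements_def)
  have "distr M N X \<Otimes>\<^sub>M distr M N' Y = distr M (N \<Otimes>\<^sub>M N') (\<lambda>\<omega>. (X \<omega>, Y \<omega>))"
  proof (rule pair_measure_eqI)
    show "sigma_finite_measure (distr M N X)" "sigma_finite_measure (distr M N' Y)"
      by (simp_all add: prob_space_distr prob_space_imp_sigma_finite)
    show "sets (distr M N X \<Otimes>\<^sub>M distr M N' Y) = sets (distr M (N \<Otimes>\<^sub>M N') (\<lambda>\<omega>. (X \<omega>, Y \<omega>)))"
      by (simp cong: sets_pair_measure_cong)
    fix A B assume A: "A \<in> sets (distr M N X)" and B: "B \<in> sets (distr M N' Y)"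
    then have "prob ((X -` A \<inter> space M) \<inter> (Y -` B \<inter> space M))
        = prob (X -` A \<inter> space M) * prob (Y -` B \<inter> space M)"
      by (intro indep_setD[OF ind]) auto
    moreover have "(\<lambda>\<omega>. (X \<omega>, Y \<omega>)) -` (A \<times> B) \<inter> space M = (X -` A \<inter> space M) \<inter> (Y -` B \<inter> space M)"
      by auto
    ultimately show "emeasure (distr M N X) A * emeasure (distr M N' Y) B
        = emeasure (distr M (N \<Otimes>\<^sub>M N') (\<lambda>\<omega>. (X \<omega>, Y \<omega>))) (A \<times> B)"
      using A B by (simp add: emeasure_distr emeasure_eq_measure ennreal_mult'[symmetric])
  qed
  then show ?thesis ..
qed

lemma sum_duration: "(\<Sum>j=1..n + 1. duration t n \<tau> j) = t"
proof -
  have "(\<Sum>j=1..n. duration t n \<tau> j) = (\<Sum>j=1..n. \<tau> j)"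
    by (intro sum.cong) (auto simp: duration_def)
  then show ?thesis by (simp add: duration_def)
qed

lemma measurable_duration [measurable]:
  assumes "j \<in> {1..n + 1}"
  shows "(\<lambda>\<tau>. duration t n \<tau> j) \<in> borel_measurable (PiM {1..n} (\<lambda>_. borel))"
proof (cases "j = n + 1")
  case True
  then show ?thesis unfolding duration_def by simp
next
  case False
  with assms have "j \<in> {1..n}" by auto
  with False show ?thesis unfolding duration_def by simp
qed

text \<open>Each power of a duration joins its Bessel factor to form one kernel, and the powers of
  \<open>Gamma a\<close> cancel. Off the open simplex the indicator on the left is matched by the
  cutoff in one of the kernels.\<close>

lemma dirichlet_density_mult_bessel_norm:
  assumes v: "bessel_family v" and a: "a > 0" and x: "x \<ge> 0"
  shows "ennreal (dirichlet_density a t n \<tau>) * (\<Prod>j=1..n + 1. ennreal (bessel_norm (v a) (x * (duration t n \<tau> j)\<^sup>2)))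
    = ennreal (Gamma (real (n + 1) * a) / t powr (real (n + 1) * a - 1))
      * ((\<Prod>j=1..n. ennreal (bessel_kernel v x a (\<tau> j))) * ennreal (bessel_kernel v x a (t - (\<Sum>j=1..n. \<tau> j))))"
proof -
  let ?K = "bessel_kernel v x a"
  let ?S = "{\<tau>. (\<forall>j\<in>{1..n}. 0 < \<tau> j) \<and> (\<Sum>j=1..n. \<tau> j) < t}"
  let ?C = "Gamma (real (n + 1) * a) / t powr (real (n + 1) * a - 1)"
  have prodK: "(\<Prod>j=1..n. ennreal (?K (\<tau> j))) * ennreal (?K (t - (\<Sum>j=1..n. \<tau> j)))
      = (\<Prod>j=1..n + 1. ennreal (?K (duration t n \<tau> j)))"
  proof -
    have "(\<Prod>j=1..n. ennreal (?K (\<tau> j))) = (\<Prod>j=1..n. ennreal (?K (duration t n \<tau> j)))"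
      by (intro prod.cong) (auto simp: duration_def)
    then show ?thesis by (simp add: duration_def)
  qed
  have K: "?K s \<ge> 0" for s by (rule bessel_kernel_nonneg[OF v a x])
  have B: "bessel_norm (v a) (x * s\<^sup>2) \<ge> 0" for s
    using bessel_familyD[OF v a] x by (intro bessel_norm_nonneg) auto
  have G: "Gamma a > 0" "Gamma (real (n + 1) * a) > 0"
    using a by (auto intro!: Gamma_real_pos)
  then have C: "?C \<ge> 0" by auto
  have D: "dirichlet_density a t n \<tau> \<ge> 0"
    unfolding dirichlet_density_def using G
    by (intro mult_nonneg_nonneg divide_nonneg_nonneg prod_nonneg) auto
  have "dirichlet_density a t n \<tau> * (\<Prod>j=1..n + 1. bessel_norm (v a) (x * (duration t n \<tau> j)\<^sup>2))
      = ?C * (\<Prod>j=1..n + 1. ?K (duration t n \<tau> j))"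
  proof (cases "\<tau> \<in> ?S")
    case True
    then have pos: "duration t n \<tau> j > 0" if "j \<in> {1..n + 1}" for j
      using that by (auto simp: duration_def)
    have "(\<Prod>j=1..n + 1. duration t n \<tau> j powr (a - 1)) * (\<Prod>j=1..n + 1. bessel_norm (v a) (x * (duration t n \<tau> j)\<^sup>2))
        = (\<Prod>j=1..n + 1. Gamma a * ?K (duration t n \<tau> j))"
      unfolding prod.distrib[symmetric] using pos G(1)
      by (intro prod.cong refl) (simp add: bessel_kernel_def less_imp_neq[THEN not_sym])
    also have "\<dots> = Gamma a ^ (n + 1) * (\<Prod>j=1..n + 1. ?K (duration t n \<tau> j))"
      by (simp only: prod.distrib prod_constant card_atLeastAtMost) simp
    finally have *: "(\<Prod>j=1..n + 1. duration t n \<tau> j powr (a - 1)) * (\<Prod>j=1..n + 1. bessel_norm (v a) (x * (duration t n \<tau> j)\<^sup>2))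
        = Gamma a ^ (n + 1) * (\<Prod>j=1..n + 1. ?K (duration t n \<tau> j))" .
    have "dirichlet_density a t n \<tau> * (\<Prod>j=1..n + 1. bessel_norm (v a) (x * (duration t n \<tau> j)\<^sup>2))
        = ?C / Gamma a ^ (n + 1) * ((\<Prod>j=1..n + 1. duration t n \<tau> j powr (a - 1)) * (\<Prod>j=1..n + 1. bessel_norm (v a) (x * (duration t n \<tau> j)\<^sup>2)))"
      unfolding dirichlet_density_def indicator_simps(1)[OF True] by (simp only: mult_ac divide_inverse)
    also have "\<dots> = ?C * (\<Prod>j=1..n + 1. ?K (duration t n \<tau> j))"
      unfolding * using G(1) by (simp del: power_Suc prod.cl_ivl_Suc add: less_imp_neq[THEN not_sym])
    finally show ?thesis .
  next
    case False
    \<comment> \<open>In either case some duration is nonpositive: one of the first n, or the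
      remaining one of index n + 1.\<close>
    then consider j where "j \<in> {1..n}" "\<tau> j \<le> 0" | "(\<Sum>j=1..n. \<tau> j) \<ge> t"
      by (force simp: not_less)
    then have "\<exists>j\<in>{1..n + 1}. ?K (duration t n \<tau> j) = 0"
    proof cases
      case (1 j)
      then show ?thesis by (intro bexI[of _ j]) (auto simp: duration_def bessel_kernel_def)
    next
      case 2
      then show ?thesis by (intro bexI[of _ "n + 1"]) (auto simp: duration_def bessel_kernel_def)
    qed
    then have "(\<Prod>j=1..n + 1. ?K (duration t n \<tau> j)) = 0"
      by (intro prod_zero) simp_all
    with False show ?thesis by (simp only: dirichlet_density_def indicator_simps(2)) simp
  qed
  then show ?thesis
    unfolding prodK using B K C D
    by (simp only: prod_ennreal ennreal_mult'[symmetric] prod_nonneg)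
qed

text \<open>Both statements of the theorem are instances: \<open>v\<close> selects the semigroup,
  and the condition on \<open>v a\<close> ties the Dirichlet parameter to the order d / 2 - 1 coming
  from the sphere.\<close>

context
  fixes M :: "'w measure" and c t a :: real and n :: nat
    and V :: "nat \<Rightarrow> 'w \<Rightarrow> real ^ 'd" and \<tau> :: "nat \<Rightarrow> 'w \<Rightarrow> real" and v :: "real \<Rightarrow> real"
  assumes flight: "random_flight M n (dirichlet_density a t n) V \<tau>"
    and d: "CARD('d) \<ge> 2" and c: "c > 0" and t: "t > 0" and a: "a > 0"
    and v: "bessel_family v" and va: "v a = real CARD('d) / 2 - 1"
begin

interpretation prob_space M
  using flight by (simp add: random_flight_def)

lemma flight_V_measurable: "j \<in> {1..n + 1} \<Longrightarrow> V j \<in> borel_measurable M"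
  using flight by (auto simp: random_flight_def indep_vars_def)

lemma flight_\<tau>_measurable: "j \<in> {1..n} \<Longrightarrow> \<tau> j \<in> borel_measurable M"
proof -
  assume j: "j \<in> {1..n}"
  have "(\<lambda>\<omega>. \<lambda>j\<in>{1..n}. \<tau> j \<omega>) \<in> measurable M (PiM {1..n} (\<lambda>_. borel))"
    using flight by (simp add: random_flight_def indep_random_elements_def)
  from measurable_compose[OF this measurable_component_singleton[OF j]] j
  show ?thesis by simp
qed

text \<open>The restrictions to the index sets exhibit the inner product as a function of the two
  random vectors whose independence is assumed.\<close>

lemma flight_position_inner:
  "\<alpha> \<bullet> flight_position c t n V \<tau> \<omega>
    = (\<Sum>j=1..n + 1. c * duration t n (\<lambda>i\<in>{1..n}. \<tau> i \<omega>) j * (\<alpha> \<bullet> (\<lambda>i\<in>{1..n + 1}. V i \<omega>) j))"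
proof -
  have "duration t n (\<lambda>i. \<tau> i \<omega>) j = duration t n (\<lambda>i\<in>{1..n}. \<tau> i \<omega>) j" if "j \<in> {1..n + 1}" for j
    using that by (auto simp: duration_def)
  then show ?thesis
    by (simp add: flight_position_def inner_sum_right sum_distrib_left mult.assoc del: sum.cl_ivl_Suc)
qed

text \<open>The joint law of directions and durations is a product measure. Integrating the
  directions first, with the durations fixed, plays the role of conditioning on the
  durations.\<close>

lemma nn_integral_exp_flight:
  "(\<integral>\<^sup>+\<omega>. ennreal (exp (\<alpha> \<bullet> flight_position c t n V \<tau> \<omega>)) \<partial>M)
    = ennreal (bessel_norm (v (real (n + 1) * a)) ((c * t * norm \<alpha>)\<^sup>2 / 4))"
proof -
  let ?X = "\<lambda>\<omega>. \<lambda>j\<in>{1..n + 1}. V j \<omega>" and ?Y = "\<lambda>\<omega>. \<lambda>j\<in>{1..n}. \<tau> j \<omega>"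
  let ?NX = "PiM {1..n + 1} (\<lambda>_. borel :: (real ^ 'd) measure)"
  let ?NY = "PiM {1..n} (\<lambda>_. borel :: real measure)"
  let ?L = "PiM {1..n} (\<lambda>_. lborel :: real measure)"
  let ?x = "(c * norm \<alpha>)\<^sup>2 / 4"
  let ?N = "real (n + 1) * a"
  \<comment> \<open>The exponential as a function of the directions x and the durations y, split
    into one factor per direction.\<close>
  define h where "h x y = (\<Prod>j=1..n + 1. ennreal (exp (c * duration t n y j * (\<alpha> \<bullet> x j))))"
    for x :: "nat \<Rightarrow> real ^ 'd" and y
  have ind: "indep_random_elements M ?NX ?X ?NY ?Y"
    using flight by (simp add: random_flight_def)
  then have XM [measurable]: "?X \<in> measurable M ?NX" and YM [measurable]: "?Y \<in> measurable M ?NY"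
    by (auto simp: indep_random_elements_def)
  interpret PX: prob_space "distr M ?NX ?X" by (rule prob_space_distr) measurable
  interpret PY: prob_space "distr M ?NY ?Y" by (rule prob_space_distr) measurable
  interpret PXY: pair_sigma_finite "distr M ?NX ?X" "distr M ?NY ?Y" ..
  have hm [measurable]: "case_prod h \<in> borel_measurable (?NX \<Otimes>\<^sub>M ?NY)"
    unfolding h_def case_prod_beta'
  proof (intro borel_measurable_prod_ennreal)
    fix j assume j: "j \<in> {1..n + 1}"
    have [measurable]: "(\<lambda>p. duration t n (snd p) j) \<in> borel_measurable (?NX \<Otimes>\<^sub>M ?NY)"
      by (rule measurable_compose[OF measurable_snd measurable_duration[OF j]])
    have [measurable]: "(\<lambda>p. fst p j) \<in> borel_measurable (?NX \<Otimes>\<^sub>M ?NY)"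
      by (rule measurable_compose[OF measurable_fst measurable_component_singleton[OF j]])
    show "(\<lambda>p. ennreal (exp (c * duration t n (snd p) j * (\<alpha> \<bullet> fst p j)))) \<in> borel_measurable (?NX \<Otimes>\<^sub>M ?NY)"
      by measurable
  qed
  have us: "distr M borel (V j) = uniform_sphere" if "j \<in> {1..n + 1}" for j
    using flight that by (simp add: random_flight_def)
  have us_prob: "prob_space (uniform_sphere :: (real ^ 'd) measure)"
    using prob_space_distr[OF flight_V_measurable[of 1]] us[of 1] by simp
  have inner: "(\<integral>\<^sup>+x. h x y \<partial>distr M ?NX ?X)
      = (\<Prod>j=1..n + 1. ennreal (bessel_norm (v a) (?x * (duration t n y j)\<^sup>2)))" for y
  proof -
    have "(\<lambda>x. h x y) \<in> borel_measurable ?NX"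
      unfolding h_def by (intro borel_measurable_prod_ennreal) measurable
    then have "(\<integral>\<^sup>+x. h x y \<partial>distr M ?NX ?X) = (\<integral>\<^sup>+\<omega>. h (?X \<omega>) y \<partial>M)"
      by (intro nn_integral_distr[OF XM]) (simp only: measurable_distr_eq1)
    also have "\<dots> = (\<integral>\<^sup>+\<omega>. (\<Prod>j\<in>{1..n + 1}. ennreal (exp (c * duration t n y j * (\<alpha> \<bullet> V j \<omega>)))) \<partial>M)"
      unfolding h_def by (intro nn_integral_cong prod.cong refl) simp
    also have "\<dots> = (\<Prod>j\<in>{1..n + 1}. \<integral>\<^sup>+\<omega>. ennreal (exp (c * duration t n y j * (\<alpha> \<bullet> V j \<omega>))) \<partial>M)"
    proof (rule indep_vars_nn_integral)
      have "indep_vars (\<lambda>_. borel) V {1..n + 1}" using flight by (simp add: random_flight_def)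
      then show "indep_vars (\<lambda>_. borel) (\<lambda>j \<omega>. ennreal (exp (c * duration t n y j * (\<alpha> \<bullet> V j \<omega>)))) {1..n + 1}"
        by (rule indep_vars_compose2) measurable
    qed auto
    also have "\<dots> = (\<Prod>j=1..n + 1. ennreal (bessel_norm (v a) (?x * (duration t n y j)\<^sup>2)))"
    proof (intro prod.cong refl)
      fix j assume j: "j \<in> {1..n + 1}"
      let ?k = "c * duration t n y j"
      have "(\<integral>\<^sup>+\<omega>. ennreal (exp (?k * (\<alpha> \<bullet> V j \<omega>))) \<partial>M)
          = (\<integral>\<^sup>+u. ennreal (exp ((?k *\<^sub>R \<alpha>) \<bullet> u)) \<partial>distr M borel (V j))"
        using flight_V_measurable[OF j] by (subst nn_integral_distr) auto
      also have "\<dots> = ennreal (bessel_norm (v a) ((norm (?k *\<^sub>R \<alpha>))\<^sup>2 / 4))"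
        unfolding us[OF j] va by (rule uniform_sphere_mgf[OF d us_prob])
      also have "(norm (?k *\<^sub>R \<alpha>))\<^sup>2 / 4 = ?x * (duration t n y j)\<^sup>2"
        by (simp add: power_mult_distrib)
      finally show "(\<integral>\<^sup>+\<omega>. ennreal (exp (?k * (\<alpha> \<bullet> V j \<omega>))) \<partial>M)
          = ennreal (bessel_norm (v a) (?x * (duration t n y j)\<^sup>2))" .
    qed
    finally show ?thesis .
  qed
  have Gm: "(\<lambda>y. \<Prod>j=1..n + 1. ennreal (bessel_norm (v a) (?x * (duration t n y j)\<^sup>2))) \<in> borel_measurable ?NY"
  proof (intro borel_measurable_prod_ennreal)
    fix j assume j: "j \<in> {1..n + 1}"
    note [measurable] = measurable_duration[OF j]
    show "(\<lambda>y. ennreal (bessel_norm (v a) (?x * (duration t n y j)\<^sup>2))) \<in> borel_measurable ?NY"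
      unfolding bessel_norm_def by measurable
  qed
  \<comment> \<open>Independence is stated over \<open>borel\<close> and the density over
    \<open>lborel\<close>; the product sigma-algebras agree, so the law of the durations can be
    transferred.\<close>
  have setsL: "sets ?NY = sets ?L" by (intro sets_PiM_cong) auto
  have dist: "distributed M ?L ?Y (\<lambda>s. ennreal (dirichlet_density a t n s))"
    using flight by (simp add: random_flight_def)
  have distrY: "distr M ?NY ?Y = density ?L (\<lambda>s. ennreal (dirichlet_density a t n s))"
    using distributed_distr_eq_density[OF dist] distr_cong[OF refl setsL, of M ?Y ?Y] by simp
  have dens [measurable]: "(\<lambda>s. ennreal (dirichlet_density a t n s)) \<in> borel_measurable ?L"
    using distributed_borel_measurable[OF dist] .
  have "(\<integral>\<^sup>+\<omega>. ennreal (exp (\<alpha> \<bullet> flight_position c t n V \<tau> \<omega>)) \<partial>M)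
      = (\<integral>\<^sup>+\<omega>. case_prod h (?X \<omega>, ?Y \<omega>) \<partial>M)"
    unfolding flight_position_inner h_def
    by (simp only: exp_sum finite_atLeastAtMost prod_ennreal exp_ge_zero case_prod_conv)
  also have "\<dots> = (\<integral>\<^sup>+p. case_prod h p \<partial>distr M (?NX \<Otimes>\<^sub>M ?NY) (\<lambda>\<omega>. (?X \<omega>, ?Y \<omega>)))"
    by (rule nn_integral_distr[symmetric]) measurable
  also have "\<dots> = (\<integral>\<^sup>+p. case_prod h p \<partial>(distr M ?NX ?X \<Otimes>\<^sub>M distr M ?NY ?Y))"
    using indep_random_elements_distr[OF prob_space_axioms ind] by simp
  also have "\<dots> = (\<integral>\<^sup>+y. \<integral>\<^sup>+x. h x y \<partial>distr M ?NX ?X \<partial>distr M ?NY ?Y)"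
  proof -
    have sets: "sets (distr M ?NX ?X \<Otimes>\<^sub>M distr M ?NY ?Y) = sets (?NX \<Otimes>\<^sub>M ?NY)"
      by (intro sets_pair_measure_cong sets_distr)
    have "case_prod h \<in> borel_measurable (distr M ?NX ?X \<Otimes>\<^sub>M distr M ?NY ?Y)"
      unfolding measurable_cong_sets[OF sets refl] by (rule hm)
    from PXY.nn_integral_snd[OF this] show ?thesis by (simp only: case_prod_conv)
  qed
  also have "\<dots> = (\<integral>\<^sup>+y. (\<Prod>j=1..n + 1. ennreal (bessel_norm (v a) (?x * (duration t n y j)\<^sup>2)))
      \<partial>density ?L (\<lambda>s. ennreal (dirichlet_density a t n s)))"
    unfolding inner distrY ..
  also have "\<dots> = (\<integral>\<^sup>+y. ennreal (dirichlet_density a t n y)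
      * (\<Prod>j=1..n + 1. ennreal (bessel_norm (v a) (?x * (duration t n y j)\<^sup>2))) \<partial>?L)"
    using Gm by (intro nn_integral_density dens) (simp add: measurable_cong_sets[OF setsL refl])
  also have "\<dots> = (\<integral>\<^sup>+y. ennreal (Gamma ?N / t powr (?N - 1))
      * ((\<Prod>j=1..n. ennreal (bessel_kernel v ?x a (y j))) * ennreal (bessel_kernel v ?x a (t - (\<Sum>j=1..n. y j)))) \<partial>?L)"
    by (intro nn_integral_cong dirichlet_density_mult_bessel_norm v a) simp
  also have "\<dots> = ennreal (Gamma ?N / t powr (?N - 1)) * ennreal (bessel_kernel v ?x ?N t)"
    using nn_integral_bessel_kernel_simplex[OF v a, of ?x n t]
    by (subst nn_integral_cmult) auto
  \<comment> \<open>The kernel at t brings in \<open>t powr (?N - 1) / Gamma ?N\<close>, which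
    cancels the normalization of the Dirichlet density.\<close>
  also have "\<dots> = ennreal (bessel_norm (v ?N) ((c * t * norm \<alpha>)\<^sup>2 / 4))"
  proof -
    have "Gamma ?N > 0" using a by (intro Gamma_real_pos) simp
    then have "Gamma ?N / t powr (?N - 1) * bessel_kernel v ?x ?N t = bessel_norm (v ?N) (?x * t\<^sup>2)"
      using t by (simp add: bessel_kernel_def less_imp_neq[THEN not_sym])
    moreover have "?x * t\<^sup>2 = (c * t * norm \<alpha>)\<^sup>2 / 4" by (simp add: power_mult_distrib)
    ultimately show ?thesis
      using \<open>Gamma ?N > 0\<close> by (subst ennreal_mult'[symmetric]) auto
  qed
  finally show ?thesis .
qed

lemma flight_position_inner_measurable:
  "(\<lambda>\<omega>. \<alpha> \<bullet> flight_position c t n V \<tau> \<omega>) \<in> borel_measurable M"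
proof -
  have "(\<lambda>\<omega>. duration t n (\<lambda>i. \<tau> i \<omega>) j) \<in> borel_measurable M" if "j \<in> {1..n + 1}" for j
    using that flight_\<tau>_measurable unfolding duration_def
    by (cases "j = n + 1") (auto intro!: borel_measurable_diff borel_measurable_sum)
  then show ?thesis
    unfolding flight_position_def inner_scaleR_right inner_sum_right
    by (intro borel_measurable_times borel_measurable_sum borel_measurable_const
        borel_measurable_inner flight_V_measurable) auto
qed

text \<open>The density vanishes unless all durations are positive, and they sum to t. A bound R for
  every direction therefore gives c t R for the position.\<close>

lemma AE_flight_bounded:
  obtains R where "AE \<omega> in M. \<bar>\<alpha> \<bullet> flight_position c t n V \<tau> \<omega>\<bar> \<le> R"
proof -
  let ?Y = "\<lambda>\<omega>. \<lambda>j\<in>{1..n}. \<tau> j \<omega>"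
  let ?L = "PiM {1..n} (\<lambda>_. lborel :: real measure)"
  let ?D = "dirichlet_density a t n"
  obtain R where R: "R \<ge> 0" "AE u in uniform_sphere. \<bar>\<alpha> \<bullet> u\<bar> \<le> R"
    using AE_uniform_sphere_inner_le by blast
  have dist: "distributed M ?L ?Y (\<lambda>s. ennreal (?D s))"
    using flight by (simp add: random_flight_def)
  have V: "AE \<omega> in M. \<forall>j\<in>{1..n + 1}. \<bar>\<alpha> \<bullet> V j \<omega>\<bar> \<le> R"
  proof (rule AE_finite_allI)
    fix j assume j: "j \<in> {1..n + 1}"
    then have "distr M borel (V j) = uniform_sphere"
      using flight by (simp add: random_flight_def)
    then have "AE u in distr M borel (V j). \<bar>\<alpha> \<bullet> u\<bar> \<le> R"
      using R(2) by (simp only:)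
    then show "AE \<omega> in M. \<bar>\<alpha> \<bullet> V j \<omega>\<bar> \<le> R"
      by (rule AE_distrD[OF flight_V_measurable[OF j]])
  qed simp
  have "AE s in density ?L (\<lambda>s. ennreal (?D s)). \<forall>j\<in>{1..n + 1}. duration t n s j > 0"
    using distributed_borel_measurable[OF dist]
    by (subst AE_density) (auto simp: dirichlet_density_def indicator_def duration_def)
  then have T: "AE \<omega> in M. \<forall>j\<in>{1..n + 1}. duration t n (?Y \<omega>) j > 0"
    unfolding distributed_distr_eq_density[OF dist, symmetric]
    using AE_distrD[OF distributed_measurable[OF dist]] by auto
  from V T have "AE \<omega> in M. \<bar>\<alpha> \<bullet> flight_position c t n V \<tau> \<omega>\<bar> \<le> c * t * R"
  proof eventually_elim
    case (elim \<omega>)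
    have "\<bar>\<alpha> \<bullet> flight_position c t n V \<tau> \<omega>\<bar> \<le> (\<Sum>j=1..n + 1. c * duration t n (?Y \<omega>) j * R)"
      unfolding flight_position_inner
    proof (rule order_trans[OF sum_abs], rule sum_mono)
      fix j assume j: "j \<in> {1..n + 1}"
      then have "\<bar>\<alpha> \<bullet> V j \<omega>\<bar> \<le> R" "duration t n (?Y \<omega>) j > 0" using elim by auto
      then show "\<bar>c * duration t n (?Y \<omega>) j * (\<alpha> \<bullet> (\<lambda>i\<in>{1..n + 1}. V i \<omega>) j)\<bar> \<le> c * duration t n (?Y \<omega>) j * R"
        using c j by (simp add: abs_mult mult_left_mono)
    qed
    also have "\<dots> = c * (\<Sum>j=1..n + 1. duration t n (?Y \<omega>) j) * R"
      by (simp only: sum_distrib_left sum_distrib_right)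
    finally show ?case by (simp only: sum_duration)
  qed
  then show ?thesis by (rule that)
qed

theorem flight_characteristic_function:
  assumes "\<alpha> \<noteq> 0"
  shows "(\<integral>\<omega>. exp (\<i> * complex_of_real (\<alpha> \<bullet> flight_position c t n V \<tau> \<omega>)) \<partial>M)
    = complex_of_real (2 powr v (real (n + 1) * a) * Gamma (v (real (n + 1) * a) + 1)
        / (c * t * norm \<alpha>) powr v (real (n + 1) * a) * Bessel_J (v (real (n + 1) * a)) (c * t * norm \<alpha>))"
proof -
  let ?Z = "\<lambda>\<omega>. \<alpha> \<bullet> flight_position c t n V \<tau> \<omega>"
  let ?v = "v (real (n + 1) * a)"
  let ?q = "(c * t * norm \<alpha>)\<^sup>2 / 4"
  have v': "?v > -1" using bessel_familyD[OF v] a by simp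
  obtain R where R: "AE \<omega> in M. \<bar>?Z \<omega>\<bar> \<le> R" using AE_flight_bounded by blast
  have "(\<lambda>k. complex_of_real (bessel_coeff ?v k * ?q ^ k * (-1) ^ k)) sums
      expectation (\<lambda>\<omega>. exp (\<i> * complex_of_real (?Z \<omega>)))"
  proof (rule char_from_mgf[OF flight_position_inner_measurable R])
    fix s
    \<comment> \<open>The factor s is moved into the vector, so that the integral computed for
      arbitrary \<alpha> yields the whole moment generating function.\<close>
    have "expectation (\<lambda>\<omega>. exp (s * ?Z \<omega>))
        = enn2real (\<integral>\<^sup>+\<omega>. ennreal (exp ((s *\<^sub>R \<alpha>) \<bullet> flight_position c t n V \<tau> \<omega>)) \<partial>M)"
      using flight_position_inner_measurable[of \<alpha>] by (subst integral_eq_nn_integral) auto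
    also have "\<dots> = bessel_norm ?v ((c * t * norm (s *\<^sub>R \<alpha>))\<^sup>2 / 4)"
      unfolding nn_integral_exp_flight using v' by (intro enn2real_ennreal bessel_norm_nonneg) auto
    also have "(c * t * norm (s *\<^sub>R \<alpha>))\<^sup>2 / 4 = ?q * s\<^sup>2"
      by (simp add: power_mult_distrib)
    finally show "(\<lambda>k. bessel_coeff ?v k * ?q ^ k * (s\<^sup>2) ^ k) sums expectation (\<lambda>\<omega>. exp (s * ?Z \<omega>))"
      using bessel_norm_sums[OF v', of "?q * s\<^sup>2"] by (simp only: power_mult_distrib mult.assoc)
  qed
  moreover have "bessel_coeff ?v k * ?q ^ k * (-1) ^ k = bessel_coeff ?v k * (- ?q) ^ k" for k
    using power_mult_distrib[of "-1" ?q k] by simp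
  ultimately have "(\<lambda>k. complex_of_real (bessel_coeff ?v k * (- ?q) ^ k)) sums
      expectation (\<lambda>\<omega>. exp (\<i> * complex_of_real (?Z \<omega>)))"
    by (simp only:)
  then have "expectation (\<lambda>\<omega>. exp (\<i> * complex_of_real (?Z \<omega>))) = complex_of_real (bessel_norm ?v (- ?q))"
    using sums_of_real[OF bessel_norm_sums[OF v', of "- ?q"]] sums_unique2 by blast
  also have "bessel_norm ?v (- ?q) = 2 powr ?v * Gamma (?v + 1) / (c * t * norm \<alpha>) powr ?v * Bessel_J ?v (c * t * norm \<alpha>)"
    using c t assms v' by (intro Bessel_J_eq_bessel_norm[symmetric]) auto
  finally show ?thesis .
qed

end

theorem theorem1:
  fixes c t :: real and n :: nat and M :: "'w measure"
  assumes "c > 0" and "t > 0" and "n \<ge> 1"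
  shows
    "(CARD('d::finite) \<ge> 2 \<longrightarrow>
       (\<forall>(V :: nat \<Rightarrow> 'w \<Rightarrow> real ^ 'd) \<tau> (\<alpha> :: real ^ 'd).
          random_flight M n (dirichlet_density (real CARD('d) - 1) t n) V \<tau> \<longrightarrow> \<alpha> \<noteq> 0 \<longrightarrow>
          (\<integral>\<omega>. exp (\<i> * complex_of_real (\<alpha> \<bullet> flight_position c t n V \<tau> \<omega>)) \<partial>M) =
          complex_of_real
            (2 powr (real (n + 1) / 2 * (real CARD('d) - 1) - 1 / 2)
               * Gamma (real (n + 1) / 2 * (real CARD('d) - 1) + 1 / 2)
               / (c * t * norm \<alpha>) powr (real (n + 1) / 2 * (real CARD('d) - 1) - 1 / 2)
               * Bessel_J (real (n + 1) / 2 * (real CARD('d) - 1) - 1 / 2) (c * t * norm \<alpha>)))) \<and>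
     (CARD('d) \<ge> 3 \<longrightarrow>
       (\<forall>(V :: nat \<Rightarrow> 'w \<Rightarrow> real ^ 'd) \<tau> (\<alpha> :: real ^ 'd).
          random_flight M n (dirichlet_density (real CARD('d) / 2 - 1) t n) V \<tau> \<longrightarrow> \<alpha> \<noteq> 0 \<longrightarrow>
          (\<integral>\<omega>. exp (\<i> * complex_of_real (\<alpha> \<bullet> flight_position c t n V \<tau> \<omega>)) \<partial>M) =
          complex_of_real
            (2 powr (real (n + 1) * (real CARD('d) / 2 - 1))
               * Gamma (real (n + 1) * (real CARD('d) / 2 - 1) + 1)
               / (c * t * norm \<alpha>) powr (real (n + 1) * (real CARD('d) / 2 - 1))
               * Bessel_J (real (n + 1) * (real CARD('d) / 2 - 1)) (c * t * norm \<alpha>))))"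
proof (intro conjI impI allI)
  fix V :: "nat \<Rightarrow> 'w \<Rightarrow> real ^ 'd" and \<tau> and \<alpha> :: "real ^ 'd"
  let ?a = "real CARD('d) - 1"
  assume d: "CARD('d) \<ge> 2" and flight: "random_flight M n (dirichlet_density ?a t n) V \<tau>" and \<alpha>: "\<alpha> \<noteq> 0"
  have order: "(real (n + 1) * ?a - 1) / 2 = real (n + 1) / 2 * ?a - 1 / 2"
    by (simp add: diff_divide_distrib)
  have order_Suc: "real (n + 1) / 2 * ?a - 1 / 2 + 1 = real (n + 1) / 2 * ?a + 1 / 2"
    by simp
  \<comment> \<open>The second fact is the order condition for this semigroup; for the other density
    it holds by \<open>refl\<close>.\<close>
  have "?a > 0" "(?a - 1) / 2 = real CARD('d) / 2 - 1" using d by (simp_all add: field_simps)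
  from flight_characteristic_function[OF flight d assms(1,2) this(1) bessel_family_half this(2) \<alpha>]
  show "(\<integral>\<omega>. exp (\<i> * complex_of_real (\<alpha> \<bullet> flight_position c t n V \<tau> \<omega>)) \<partial>M) =
      complex_of_real
        (2 powr (real (n + 1) / 2 * ?a - 1 / 2) * Gamma (real (n + 1) / 2 * ?a + 1 / 2)
           / (c * t * norm \<alpha>) powr (real (n + 1) / 2 * ?a - 1 / 2)
           * Bessel_J (real (n + 1) / 2 * ?a - 1 / 2) (c * t * norm \<alpha>))"
    unfolding order order_Suc .
next
  fix V :: "nat \<Rightarrow> 'w \<Rightarrow> real ^ 'd" and \<tau> and \<alpha> :: "real ^ 'd"
  let ?a = "real CARD('d) / 2 - 1"
  assume d: "CARD('d) \<ge> 3" and flight: "random_flight M n (dirichlet_density ?a t n) V \<tau>" and \<alpha>: "\<alpha> \<noteq> 0"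
  from d have "CARD('d) \<ge> 2" "?a > 0" by auto
  from flight_characteristic_function[OF flight this(1) assms(1,2) this(2) bessel_family_id refl \<alpha>]
  show "(\<integral>\<omega>. exp (\<i> * complex_of_real (\<alpha> \<bullet> flight_position c t n V \<tau> \<omega>)) \<partial>M) =
      complex_of_real
        (2 powr (real (n + 1) * ?a) * Gamma (real (n + 1) * ?a + 1) / (c * t * norm \<alpha>) powr (real (n + 1) * ?a)
           * Bessel_J (real (n + 1) * ?a) (c * t * norm \<alpha>))" .
qed

end
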